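(* Let $a,b,m,n$ be positive integers with $am-bn\in\{-1,1\}$. Let $g$ be holomorphic near $0\in\mathbb{C}$ and let $f$ be meromorphic near $0\in\mathbb{C}$ such that the map $(x,y)\mapsto x^a y^b f(x^n y^m)$ is holomorphic near $(0,0)\in\mathbb{C}^2$ with order at least $1$ at the origin. Consider the (commuting) holomorphic vector fields defined near $(0,0)\in\mathbb{C}^2$ by $$X = x^a y^b\left[ m x \frac{\partial}{\partial x} - n y \frac{\partial}{\partial y}\right],$$ $$Y = g(x^n y^m)\left[ x\left(-bm + x^a y^b f(x^n y^m)\right)\frac{\partial}{\partial x} + y\left(am - \frac{n}{m}x^a y^b f(x^n y^m)\right)\frac{\partial}{\partial y}\right].$$ Let $f_0$ be the constant term of the Laurent expansion of $f$ around $0$. Assume that one of the following conditions holds: (1) $g(0)\neq 0$; (2) $g(0)=g''(0)=f_0=0$ but $g'(0)\neq 0$. Then the Lie algebra generated by $X$ and $Y$ is univalent on a sufficiently small neighborhood $U$ of $(0,0)\in\mathbb{C}^2$.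
   Context: Let $G$ be a complex Lie group with identity $e$ and $M$ a complex manifold. A local $G$-action on $M$ is a holomorphic map $\Phi:\Omega\subset G\times M\to M$, where $\Omega$ is a connected open set containing $\{e\}\times M$, with $\Phi(e,p)=p$ for all $p\in M$, and $\Phi(g_1g_2,p)=\Phi(g_1,\Phi(g_2,p))$ whenever both sides are defined. It is maximal if, with $V_p=\{g\in G:(g,p)\in\Omega\}$, for every $p\in M$ and every sequence $\{g_i\}\subset V_p$ converging to a boundary point of $V_p$ in $G$, the sequence $\Phi(g_i,p)$ leaves every compact subset of $M$. A finite-dimensional Lie algebra of holomorphic vector fields on $M$ is univalent on $M$ if it integrates to a maximal local action of a corresponding Lie group on $M$; here the Lie algebra generated by $X$ and $Y$ is abelian of dimension $2$ and the group is $\mathbb{C}^2$. *)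

theory Defs
  imports "HOL-Complex_Analysis.Complex_Analysis"
begin

text \<open>Complex scalar multiplication, needed to speak of complex-linear derivatives between
  products of copies of \<open>\<complex>\<close>.\<close>

class complex_normed_space = real_normed_vector +
  fixes scaleC :: "complex \<Rightarrow> 'a \<Rightarrow> 'a"  (infixr "*\<^sub>C" 75)
  assumes scaleC_add_right: "c *\<^sub>C (v + w) = c *\<^sub>C v + c *\<^sub>C w"
    and scaleC_add_left: "(c + d) *\<^sub>C v = c *\<^sub>C v + d *\<^sub>C v"
    and scaleC_scaleC: "c *\<^sub>C d *\<^sub>C v = (c * d) *\<^sub>C v"
    and scaleC_of_real: "complex_of_real r *\<^sub>C v = r *\<^sub>R v"
    and norm_scaleC: "norm (c *\<^sub>C v) = cmod c * norm v"

instantiation complex :: complex_normed_space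
begin

definition scaleC_complex :: "complex \<Rightarrow> complex \<Rightarrow> complex" where
  "c *\<^sub>C z = c * z"

instance
  by standard (auto simp: scaleC_complex_def algebra_simps scaleR_conv_of_real norm_mult)

end

instantiation prod :: (complex_normed_space, complex_normed_space) complex_normed_space
begin

definition scaleC_prod :: "complex \<Rightarrow> 'a \<times> 'b \<Rightarrow> 'a \<times> 'b" where
  "c *\<^sub>C p = (c *\<^sub>C fst p, c *\<^sub>C snd p)"

instance
  by standard
    (auto simp: scaleC_prod_def scaleC_add_right scaleC_add_left scaleC_scaleC scaleC_of_real
      scaleR_prod_def norm_scaleC norm_prod_def power_mult_distrib real_sqrt_mult
      simp flip: distrib_left)

end

text \<open>Holomorphy in several variables on an open set: complex-linear Frechet derivatives.\<close>

definition multi_holomorphic_on ::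
    "('a::complex_normed_space \<Rightarrow> 'b::complex_normed_space) \<Rightarrow> 'a set \<Rightarrow> bool"
    (infixl "multi'_holomorphic'_on" 50) where
  "F multi_holomorphic_on S \<longleftrightarrow>
     open S \<and>
     (\<forall>p\<in>S. \<exists>D. (F has_derivative D) (at p) \<and> (\<forall>c v. D (c *\<^sub>C v) = c *\<^sub>C D v))"

text \<open>Local actions of the additive Lie group of a complex vector space on an open subset
  \<open>M\<close> of a complex vector space.\<close>

definition local_action ::
    "'m::complex_normed_space set \<Rightarrow> ('g::complex_normed_space \<times> 'm) set \<Rightarrow> ('g \<times> 'm \<Rightarrow> 'm) \<Rightarrow> bool"
  where
  "local_action M \<Omega> \<Phi> \<longleftrightarrow>
     open M \<and> open \<Omega> \<and> connected \<Omega> \<and> {0} \<times> M \<subseteq> \<Omega> \<and> \<Omega> \<subseteq> UNIV \<times> M \<and>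
     \<Phi> multi_holomorphic_on \<Omega> \<and> \<Phi> ` \<Omega> \<subseteq> M \<and>
     (\<forall>p\<in>M. \<Phi> (0, p) = p) \<and>
     (\<forall>g1 g2 p. (g1 + g2, p) \<in> \<Omega> \<longrightarrow> (g2, p) \<in> \<Omega> \<longrightarrow> (g1, \<Phi> (g2, p)) \<in> \<Omega> \<longrightarrow>
        \<Phi> (g1 + g2, p) = \<Phi> (g1, \<Phi> (g2, p)))"

definition action_domain :: "('g \<times> 'm) set \<Rightarrow> 'm \<Rightarrow> 'g set" where
  "action_domain \<Omega> p = {g. (g, p) \<in> \<Omega>}"

definition maximal_local_action ::
    "'m::complex_normed_space set \<Rightarrow> ('g::complex_normed_space \<times> 'm) set \<Rightarrow> ('g \<times> 'm \<Rightarrow> 'm) \<Rightarrow> bool"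
  where
  "maximal_local_action M \<Omega> \<Phi> \<longleftrightarrow>
     local_action M \<Omega> \<Phi> \<and>
     (\<forall>p\<in>M. \<forall>s \<gamma>. (\<forall>i. s i \<in> action_domain \<Omega> p) \<longrightarrow>
        \<gamma> \<in> frontier (action_domain \<Omega> p) \<longrightarrow> s \<longlonglongrightarrow> \<gamma> \<longrightarrow>
        (\<forall>K. compact K \<longrightarrow> K \<subseteq> M \<longrightarrow> (\<forall>\<^sub>F i in sequentially. \<Phi> (s i, p) \<notin> K)))"

text \<open>A vector field on \<open>M\<close> is a function that is set to \<open>0\<close> outside \<open>M\<close>, so that
  equality of functions is equality of vector fields on \<open>M\<close>.\<close>

definition restrict_field :: "'m set \<Rightarrow> ('m \<Rightarrow> 'm) \<Rightarrow> 'm \<Rightarrow> 'm::zero" where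
  "restrict_field M X = (\<lambda>p. if p \<in> M then X p else 0)"

definition lie_bracket :: "('m \<Rightarrow> 'm) \<Rightarrow> ('m \<Rightarrow> 'm) \<Rightarrow> 'm \<Rightarrow> 'm::real_normed_vector" where
  "lie_bracket X Y p = frechet_derivative Y (at p) (X p) - frechet_derivative X (at p) (Y p)"

inductive_set generated_lie_algebra ::
    "'m::complex_normed_space set \<Rightarrow> ('m \<Rightarrow> 'm) set \<Rightarrow> ('m \<Rightarrow> 'm) set"
  for M :: "'m set" and S :: "('m \<Rightarrow> 'm) set" where
  generator: "X \<in> S \<Longrightarrow> restrict_field M X \<in> generated_lie_algebra M S"
| zero: "(\<lambda>p. 0) \<in> generated_lie_algebra M S"
| add: "X \<in> generated_lie_algebra M S \<Longrightarrow> Y \<in> generated_lie_algebra M S \<Longrightarrow>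
    (\<lambda>p. X p + Y p) \<in> generated_lie_algebra M S"
| scale: "X \<in> generated_lie_algebra M S \<Longrightarrow> (\<lambda>p. c *\<^sub>C X p) \<in> generated_lie_algebra M S"
| bracket: "X \<in> generated_lie_algebra M S \<Longrightarrow> Y \<in> generated_lie_algebra M S \<Longrightarrow>
    restrict_field M (lie_bracket X Y) \<in> generated_lie_algebra M S"

definition fundamental_field ::
    "'m set \<Rightarrow> ('g \<times> 'm \<Rightarrow> 'm) \<Rightarrow> 'g::real_normed_vector \<Rightarrow> 'm \<Rightarrow> 'm::real_normed_vector" where
  "fundamental_field M \<Phi> v =
     restrict_field M (\<lambda>p. frechet_derivative (\<lambda>g. \<Phi> (g, p)) (at 0) v)"

text \<open>Univalence of a Lie algebra \<open>L\<close> of vector fields whose corresponding Lie group is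
  \<open>\<complex>\<^sup>2\<close>: some maximal local action of \<open>\<complex>\<^sup>2\<close> has \<open>L\<close> as its Lie algebra of
  fundamental fields.  The map \<open>fundamental_field M \<Phi>\<close> is automatically linear and
  bracket-preserving, so bijectivity says that it identifies the Lie algebra of
  \<open>\<complex>\<^sup>2\<close> with \<open>L\<close>.\<close>

definition univalent_C2_on ::
    "('m::complex_normed_space \<Rightarrow> 'm) set \<Rightarrow> 'm set \<Rightarrow> bool" where
  "univalent_C2_on L M \<longleftrightarrow>
     (\<exists>\<Omega> (\<Phi> :: (complex \<times> complex) \<times> 'm \<Rightarrow> 'm).
        maximal_local_action M \<Omega> \<Phi> \<and> bij_betw (fundamental_field M \<Phi>) UNIV L)"

definition field_X :: "nat \<Rightarrow> nat \<Rightarrow> nat \<Rightarrow> nat \<Rightarrow> complex \<times> complex \<Rightarrow> complex \<times> complex" where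
  "field_X a b m n = (\<lambda>(x, y).
     (x ^ a * y ^ b * (of_nat m * x), x ^ a * y ^ b * (- (of_nat n * y))))"

text \<open>The argument \<open>F\<close> stands for the holomorphic function \<open>x\<^sup>a y\<^sup>b f(x\<^sup>n y\<^sup>m)\<close>.  If
  \<open>f\<close> has a pole at \<open>0\<close>, its extension to the axes is not given by that formula, since
  \<open>f 0\<close> is then a dummy value.\<close>

definition field_Y ::
    "nat \<Rightarrow> nat \<Rightarrow> nat \<Rightarrow> nat \<Rightarrow> (complex \<Rightarrow> complex) \<Rightarrow> (complex \<times> complex \<Rightarrow> complex) \<Rightarrow>
     complex \<times> complex \<Rightarrow> complex \<times> complex" where
  "field_Y a b m n g F = (\<lambda>(x, y).
     (g (x ^ n * y ^ m) * (x * (- of_nat (b * m) + F (x, y))),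
      g (x ^ n * y ^ m) * (y * (of_nat (a * m) - of_nat n / of_nat m * F (x, y)))))"

end

theory Submission
  imports Defs
begin

text \<open>
  Put \<open>\<epsilon> = am - bn = \<plusminus>1\<close>.  The monomials \<open>z = x^n y^m\<close> and \<open>w = x^a y^b\<close> are coordinates off the
  axes, since their exponent matrix has determinant \<open>\<plusminus>1\<close>, and there
  \<open>X = \<epsilon> w^2 \<partial>/\<partial>w\<close> and \<open>Y = \<epsilon> m z g(z) \<partial>/\<partial>z + (\<epsilon>/m) g(z) f(z) w^2 \<partial>/\<partial>w\<close>.
  So \<open>z\<close> runs along a flow of one variable, \<open>z \<mapsto> z E(t, z)\<close>, and \<open>1/w\<close> is translated:
  after the times \<open>s\<close> of \<open>X\<close> and \<open>t\<close> of \<open>Y\<close> it has become \<open>1/w - \<epsilon> s - K(t, z)\<close>, where \<open>K\<close> is the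
  integral of \<open>(\<epsilon>/m) g f\<close> along the orbit of \<open>z\<close>, which is also \<open>1/m^2\<close> times the integral of
  \<open>f(z) dz/z\<close>.  Solving for \<open>x\<close> and \<open>y\<close> gives the closed form
  \<open>(x E^{-\<epsilon>b} \<Delta>^{-\<epsilon>m}, y E^{\<epsilon>a} \<Delta>^{\<epsilon>n})\<close> with \<open>\<Delta> = 1 - \<epsilon> s w - w K\<close>.

  The action is univalent as soon as \<open>E\<close> and \<open>K\<close> are single-valued functions of the time \<open>t\<close>, and
  two residues decide that.  If \<open>g(0) \<noteq> 0\<close>, a change of the coordinate \<open>z\<close> makes the flow linear,
  \<open>\<zeta> \<mapsto> e^{lt} \<zeta>\<close>, and the logarithm that the constant term of \<open>f\<close> contributes to \<open>K\<close> is a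
  multiple of \<open>t\<close> up to a single-valued function of the end points.  If \<open>g\<close> has a simple zero, the
  hypothesis \<open>g''(0) = 0\<close> says that \<open>dz/(z g(z))\<close> has residue \<open>0\<close>; the flow is then conjugate to
  \<open>\<zeta> \<mapsto> \<zeta>/(1 - t\<zeta>)\<close>, and the vanishing constant term of \<open>f\<close> removes the logarithm from \<open>K\<close>.  The
  conjugation is \<open>scaling_flow_conjugate\<close>, and the integrations are instances of \<open>euler_primitive\<close>.

  A pole of \<open>f\<close> does no harm on the axes.  Write \<open>f = h/z^k\<close>.  If \<open>k > 0\<close> and \<open>h(0) \<noteq> 0\<close>, holomorphy
  of \<open>F\<close> forces \<open>a = \<alpha> + kn\<close> and \<open>b = \<beta> + km\<close> with natural numbers \<open>\<alpha>\<close>, \<open>\<beta>\<close> (lemma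
  \<open>extension_formula\<close>), and \<open>w K\<close> becomes \<open>x^\<alpha> y^\<beta>\<close> times a holomorphic function \<open>\<kappa>\<close> of \<open>(t, z)\<close>.
  The group law of the closed form reduces to cocycle identities for \<open>E\<close> and \<open>\<kappa>\<close>, valid on the axes
  too.

  The closed form is defined wherever the flow of \<open>z\<close> is and \<open>\<Delta> \<noteq> 0\<close>, and its values cannot converge
  inside the neighbourhood when the time leaves this domain (lemma \<open>\<Phi>_maximal\<close>): when \<open>\<Delta>\<close> tends
  to \<open>0\<close>, a coordinate tends to infinity.  For any such map, cutting down to a connected open set
  \<open>U\<close>, and to the connected component of time \<open>0\<close> over each point, gives a maximal local action
  (lemma \<open>maximal_local_action_restrict\<close>).
\<close>

section \<open>Complex differentiability in several variables\<close>

definition cdifferentiable_at ::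
    "('a::complex_normed_space \<Rightarrow> 'b::complex_normed_space) \<Rightarrow> 'a \<Rightarrow> bool"
    (infix "cdifferentiable'_at" 50) where
  "F cdifferentiable_at p \<longleftrightarrow>
     (\<exists>D. (F has_derivative D) (at p) \<and> (\<forall>c v. D (c *\<^sub>C v) = c *\<^sub>C D v))"

lemma multi_holomorphic_on_iff:
  "F multi_holomorphic_on S \<longleftrightarrow> open S \<and> (\<forall>p\<in>S. F cdifferentiable_at p)"
  by (auto simp: multi_holomorphic_on_def cdifferentiable_at_def)

lemma cdifferentiable_imp_isCont: "F cdifferentiable_at p \<Longrightarrow> isCont F p"
  by (auto simp: cdifferentiable_at_def dest: has_derivative_continuous)

lemma scaleC_zero_right [simp]: "c *\<^sub>C (0::'a::complex_normed_space) = 0"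
  using scaleC_add_right[of c 0 "0::'a"] by simp

lemma cdifferentiable_const: "(\<lambda>x. v) cdifferentiable_at p"
  unfolding cdifferentiable_at_def by (rule exI[of _ "\<lambda>_. 0"]) auto

lemma cdifferentiable_compose:
  assumes "F cdifferentiable_at p" "G cdifferentiable_at (F p)"
  shows "(\<lambda>x. G (F x)) cdifferentiable_at p"
proof -
  from assms obtain D D' where D: "(F has_derivative D) (at p)" "\<And>c v. D (c *\<^sub>C v) = c *\<^sub>C D v"
    "(G has_derivative D') (at (F p))" "\<And>c v. D' (c *\<^sub>C v) = c *\<^sub>C D' v"
    unfolding cdifferentiable_at_def by blast
  show ?thesis unfolding cdifferentiable_at_def
    by (rule exI[of _ "\<lambda>v. D' (D v)"]) (use has_derivative_compose[OF D(1,3)] D(2,4) in auto)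
qed

lemma cdifferentiable_fst:
  assumes "F cdifferentiable_at p" shows "(\<lambda>x. fst (F x)) cdifferentiable_at p"
proof -
  from assms obtain D where D: "(F has_derivative D) (at p)" "\<And>c v. D (c *\<^sub>C v) = c *\<^sub>C D v"
    unfolding cdifferentiable_at_def by blast
  show ?thesis unfolding cdifferentiable_at_def
    by (rule exI[of _ "\<lambda>v. fst (D v)"])
      (use has_derivative_fst[OF D(1)] D(2) in \<open>auto simp: scaleC_prod_def\<close>)
qed

lemma cdifferentiable_snd:
  assumes "F cdifferentiable_at p" shows "(\<lambda>x. snd (F x)) cdifferentiable_at p"
proof -
  from assms obtain D where D: "(F has_derivative D) (at p)" "\<And>c v. D (c *\<^sub>C v) = c *\<^sub>C D v"
    unfolding cdifferentiable_at_def by blast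
  show ?thesis unfolding cdifferentiable_at_def
    by (rule exI[of _ "\<lambda>v. snd (D v)"])
      (use has_derivative_snd[OF D(1)] D(2) in \<open>auto simp: scaleC_prod_def\<close>)
qed

lemma cdifferentiable_ident: "(\<lambda>x. x) cdifferentiable_at p"
  unfolding cdifferentiable_at_def by (rule exI[of _ "\<lambda>v. v"]) auto

lemma cdifferentiable_Pair:
  assumes "F cdifferentiable_at p" "G cdifferentiable_at p"
  shows "(\<lambda>x. (F x, G x)) cdifferentiable_at p"
proof -
  from assms obtain D D' where D: "(F has_derivative D) (at p)" "\<And>c v. D (c *\<^sub>C v) = c *\<^sub>C D v"
    "(G has_derivative D') (at p)" "\<And>c v. D' (c *\<^sub>C v) = c *\<^sub>C D' v"
    unfolding cdifferentiable_at_def by blast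
  show ?thesis unfolding cdifferentiable_at_def
    by (rule exI[of _ "\<lambda>v. (D v, D' v)"])
      (use has_derivative_Pair[OF D(1,3)] D(2,4) in \<open>auto simp: scaleC_prod_def\<close>)
qed

lemma cdifferentiable_diff:
  assumes "F cdifferentiable_at p" "G cdifferentiable_at p"
  shows "(\<lambda>x. F x - G x :: complex) cdifferentiable_at p"
proof -
  from assms obtain D D' where D: "(F has_derivative D) (at p)" "\<And>c v. D (c *\<^sub>C v) = c *\<^sub>C D v"
    "(G has_derivative D') (at p)" "\<And>c v. D' (c *\<^sub>C v) = c *\<^sub>C D' v"
    unfolding cdifferentiable_at_def by blast
  show ?thesis unfolding cdifferentiable_at_def
    by (rule exI[of _ "\<lambda>v. D v - D' v"])
      (use has_derivative_diff[OF D(1,3)] D(2,4) in \<open>auto simp: scaleC_complex_def algebra_simps\<close>)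
qed

lemma cdifferentiable_add:
  assumes "F cdifferentiable_at p" "G cdifferentiable_at p"
  shows "(\<lambda>x. F x + G x :: complex) cdifferentiable_at p"
proof -
  from assms obtain D D' where D: "(F has_derivative D) (at p)" "\<And>c v. D (c *\<^sub>C v) = c *\<^sub>C D v"
    "(G has_derivative D') (at p)" "\<And>c v. D' (c *\<^sub>C v) = c *\<^sub>C D' v"
    unfolding cdifferentiable_at_def by blast
  show ?thesis unfolding cdifferentiable_at_def
    by (rule exI[of _ "\<lambda>v. D v + D' v"])
      (use has_derivative_add[OF D(1,3)] D(2,4) in \<open>auto simp: scaleC_complex_def algebra_simps\<close>)
qed

lemma cdifferentiable_mult:
  assumes "F cdifferentiable_at p" "G cdifferentiable_at p"
  shows "(\<lambda>x. F x * G x :: complex) cdifferentiable_at p"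
proof -
  from assms obtain D D' where D: "(F has_derivative D) (at p)" "\<And>c v. D (c *\<^sub>C v) = c *\<^sub>C D v"
    "(G has_derivative D') (at p)" "\<And>c v. D' (c *\<^sub>C v) = c *\<^sub>C D' v"
    unfolding cdifferentiable_at_def by blast
  show ?thesis unfolding cdifferentiable_at_def
    by (rule exI[of _ "\<lambda>v. F p * D' v + D v * G p"])
      (use has_derivative_mult[OF D(1,3)] D(2,4) in \<open>auto simp: scaleC_complex_def algebra_simps\<close>)
qed

lemma cdifferentiable_field_compose:
  fixes h :: "complex \<Rightarrow> complex"
  assumes "F cdifferentiable_at p" "h field_differentiable (at (F p))"
  shows "(\<lambda>x. h (F x)) cdifferentiable_at p"
proof (rule cdifferentiable_compose[OF assms(1)])
  from assms(2) obtain h' where "(h has_field_derivative h') (at (F p))"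
    unfolding field_differentiable_def by blast
  then show "h cdifferentiable_at (F p)"
    unfolding cdifferentiable_at_def has_field_derivative_def
    by (intro exI[of _ "(*) h'"]) (auto simp: scaleC_complex_def)
qed

lemma cdifferentiable_power:
  "F cdifferentiable_at p \<Longrightarrow> (\<lambda>x. F x ^ k :: complex) cdifferentiable_at p"
  by (rule cdifferentiable_field_compose[where h = "\<lambda>z. z ^ k"]) (auto intro: field_differentiable_power field_differentiable_ident)

lemma cdifferentiable_power_int:
  assumes "F cdifferentiable_at p" "F p \<noteq> 0"
  shows "(\<lambda>x. F x powi k :: complex) cdifferentiable_at p"
  by (rule cdifferentiable_field_compose[OF assms(1), where h = "\<lambda>z. z powi k"])
    (use assms(2) in \<open>auto intro: DERIV_power_int[OF DERIV_ident] simp: field_differentiable_def\<close>)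

lemma cdifferentiable_divide:
  assumes "F cdifferentiable_at p" "G cdifferentiable_at p" "G p \<noteq> 0"
  shows "(\<lambda>x. F x / G x :: complex) cdifferentiable_at p"
  using cdifferentiable_mult[OF assms(1) cdifferentiable_power_int[OF assms(2,3), of "-1"]]
  by (simp add: power_int_minus divide_inverse)

lemmas cdifferentiable_intros =
  cdifferentiable_const cdifferentiable_ident cdifferentiable_fst cdifferentiable_snd
  cdifferentiable_Pair cdifferentiable_add cdifferentiable_diff cdifferentiable_mult
  cdifferentiable_power cdifferentiable_power_int cdifferentiable_divide

section \<open>Maximal local actions from closed partial actions\<close>

text \<open>
  Over \<open>p\<close> the times are restricted to the component of \<open>0\<close> in the set of those that keep \<open>p\<close> in \<open>U\<close>.
  Fibrewise connectedness makes the total domain connected, because every fibre meets \<open>{0} \<times> U\<close>.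
  For maximality, suppose that the orbit keeps returning to a compact set while the time
  tends to a boundary point \<open>\<gamma>\<close>.  A subsequence of the orbit converges in \<open>U\<close>, so by the closedness
  hypothesis the map is defined at \<open>\<gamma>\<close> with a value in \<open>U\<close>; but then a whole ball around \<open>\<gamma>\<close> lies in
  the same component, and \<open>\<gamma>\<close> is not on the boundary.
\<close>

lemma maximal_local_action_restrict:
  fixes \<Phi> :: "'g::complex_normed_space \<times> 'm::complex_normed_space \<Rightarrow> 'm"
  assumes holo: "\<Phi> multi_holomorphic_on \<Omega>" and U: "open U" "connected U"
    and zero: "\<And>p. p \<in> U \<Longrightarrow> (0, p) \<in> \<Omega> \<and> \<Phi> (0, p) = p"
    and act: "\<And>g1 g2 p. (g2, p) \<in> \<Omega> \<Longrightarrow> (g1, \<Phi> (g2, p)) \<in> \<Omega> \<Longrightarrow> (g1 + g2, p) \<in> \<Omega> \<Longrightarrow>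
               \<Phi> (g1 + g2, p) = \<Phi> (g1, \<Phi> (g2, p))"
    and clos: "\<And>p s \<gamma> q. (\<And>i. (s i, p) \<in> \<Omega>) \<Longrightarrow> s \<longlonglongrightarrow> \<gamma> \<Longrightarrow>
               (\<lambda>i. \<Phi> (s i, p)) \<longlonglongrightarrow> q \<Longrightarrow> q \<in> U \<Longrightarrow> (\<gamma>, p) \<in> \<Omega>"
  shows "maximal_local_action U
    {(g, p). p \<in> U \<and> connected_component {g. (g, p) \<in> \<Omega> \<and> \<Phi> (g, p) \<in> U} 0 g} \<Phi>"
proof -
  define R where "R = {(g, p). (g, p) \<in> \<Omega> \<and> p \<in> U \<and> \<Phi> (g, p) \<in> U}"
  define V where "V p = {g. (g, p) \<in> \<Omega> \<and> \<Phi> (g, p) \<in> U}" for p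
  define \<Omega>' where "\<Omega>' = {(g, p). p \<in> U \<and> connected_component (V p) 0 g}"
  have openO: "open \<Omega>" and cont: "\<And>q. q \<in> \<Omega> \<Longrightarrow> isCont \<Phi> q"
    using holo by (auto simp: multi_holomorphic_on_iff intro: cdifferentiable_imp_isCont)
  have openR: "open R"
  proof -
    have "open (\<Omega> \<inter> \<Phi> -` U)"
      using openO cont U(1) by (intro continuous_open_preimage) (auto intro: continuous_at_imp_continuous_on)
    then have "open ((\<Omega> \<inter> \<Phi> -` U) \<inter> (UNIV \<times> U))"
      using U(1) by (intro open_Int[OF _ open_Times]) auto
    also have "(\<Omega> \<inter> \<Phi> -` U) \<inter> (UNIV \<times> U) = R" by (auto simp: R_def)
    finally show ?thesis .
  qed
  have openV: "open (V p)" if "p \<in> U" for p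
  proof -
    have "open ((\<lambda>g. (g, p)) -` R)"
      by (rule open_vimage[OF openR]) (intro continuous_intros)
    also have "(\<lambda>g. (g, p)) -` R = V p" using that by (auto simp: R_def V_def)
    finally show ?thesis .
  qed
  have zeroV: "0 \<in> V p" if "p \<in> U" for p using zero[OF that] that by (simp add: V_def)
  have sub: "\<Omega>' \<subseteq> R"
    unfolding \<Omega>'_def R_def using connected_component_in by (fastforce simp: V_def)
  have zero': "(0, p) \<in> \<Omega>'" if "p \<in> U" for p
    using zeroV[OF that] that by (simp add: \<Omega>'_def)
  have open': "open \<Omega>'"
  proof (rule Topological_Spaces.openI)
    fix q assume "q \<in> \<Omega>'"
    then obtain g p where q: "q = (g, p)" "p \<in> U" "connected_component (V p) 0 g"
      by (auto simp: \<Omega>'_def)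
    have "(g, p) \<in> R" using sub \<open>q \<in> \<Omega>'\<close> q(1) by auto
    then obtain A N' where A: "open A" "open N'" "g \<in> A" "p \<in> N'" "A \<times> N' \<subseteq> R"
      using openR by (auto elim!: open_prod_elim)
    then obtain e where e: "e > 0" "ball g e \<subseteq> A" by (meson open_contains_ball)
    \<comment> \<open>A path from \<open>0\<close> to \<open>g\<close> is compact, so the tube lemma keeps it inside the neighbouring fibres.\<close>
    have "path_component (V p) 0 g"
      using q(3) open_path_connected_component[OF openV[OF q(2)]] by simp
    then obtain \<gamma> where \<gamma>: "path \<gamma>" "path_image \<gamma> \<subseteq> V p" "pathstart \<gamma> = 0" "pathfinish \<gamma> = g"
      by (auto simp: path_component_def)
    have swap: "open (prod.swap -` R)"
      by (rule open_vimage[OF openR]) (simp add: prod.swap_def, intro continuous_intros)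
    have path: "{p} \<times> path_image \<gamma> \<subseteq> prod.swap -` R"
      using \<gamma>(2) q(2) by (auto simp: R_def V_def)
    obtain N where N: "p \<in> N" "open N" "N \<times> path_image \<gamma> \<subseteq> prod.swap -` R"
      using Elementary_Topology.tube_lemma[OF compact_path_image[OF \<gamma>(1)] swap path] by (elim exE conjE)
    have "(h, p') \<in> \<Omega>'" if "h \<in> ball g e" "p' \<in> N" "p' \<in> N'" for h p'
    proof -
      have g: "g \<in> path_image \<gamma>" "0 \<in> path_image \<gamma>"
        using \<gamma>(3,4) pathfinish_in_path_image[of \<gamma>] pathstart_in_path_image[of \<gamma>] by simp_all
      have "connected (path_image \<gamma> \<union> ball g e)"
        using \<gamma>(1) e(1) g by (intro connected_Un connected_path_image) auto
      moreover have "path_image \<gamma> \<union> ball g e \<subseteq> V p'"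
        using that A N(3) e(2) by (auto simp: R_def V_def)
      ultimately have "connected_component (V p') 0 h" using that(1) g(2)
        unfolding connected_component_def by blast
      moreover have "(h, p') \<in> R" using that A e by auto
      ultimately show ?thesis by (simp add: \<Omega>'_def R_def)
    qed
    then have "ball g e \<times> (N \<inter> N') \<subseteq> \<Omega>'" by auto
    then show "\<exists>T. open T \<and> q \<in> T \<and> T \<subseteq> \<Omega>'"
      using N A q(1) e(1) by (intro exI[of _ "ball g e \<times> (N \<inter> N')"]) (auto intro!: open_Times)
  qed
  have conn': "connected \<Omega>'"
  proof -
    have "\<Omega>' = \<Union>((\<lambda>p. {0} \<times> U \<union> connected_component_set (V p) 0 \<times> {p}) ` U)"
      using zero' by (auto simp: \<Omega>'_def)
    moreover have "connected (\<Union>((\<lambda>p. {0} \<times> U \<union> connected_component_set (V p) 0 \<times> {p}) ` U))"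
    proof (rule connected_Union)
      fix S assume "S \<in> (\<lambda>p. {0} \<times> U \<union> connected_component_set (V p) 0 \<times> {p}) ` U"
      then obtain p where p: "p \<in> U" "S = {0} \<times> U \<union> connected_component_set (V p) 0 \<times> {p}"
        by auto
      show "connected S" unfolding p(2)
      proof (rule connected_Un)
        show "connected ({0::'g} \<times> U)" by (intro connected_Times connected_sing U(2))
        show "connected (connected_component_set (V p) 0 \<times> {p})"
          by (intro connected_Times connected_sing connected_connected_component)
        have "(0, p) \<in> {0} \<times> U \<inter> connected_component_set (V p) 0 \<times> {p}"
          using p(1) zeroV[OF p(1)] by simp
        then show "{0} \<times> U \<inter> connected_component_set (V p) 0 \<times> {p} \<noteq> {}" by blast
      qed
    next
      show "\<Inter> ((\<lambda>p. {0} \<times> U \<union> connected_component_set (V p) 0 \<times> {p}) ` U) \<noteq> {}"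
        by (cases "U = {}") auto
    qed
    ultimately show ?thesis by simp
  qed
  have local: "local_action U \<Omega>' \<Phi>"
    unfolding local_action_def
  proof (intro conjI allI impI ballI)
    show "\<Phi> multi_holomorphic_on \<Omega>'"
      using holo open' sub by (auto simp: multi_holomorphic_on_iff R_def)
    show "\<Phi> (g1 + g2, p) = \<Phi> (g1, \<Phi> (g2, p))"
      if "(g1 + g2, p) \<in> \<Omega>'" "(g2, p) \<in> \<Omega>'" "(g1, \<Phi> (g2, p)) \<in> \<Omega>'" for g1 g2 p
      using that sub by (intro act) (auto simp: R_def)
  qed (use U open' conn' zero' sub zero in \<open>auto simp: R_def \<Omega>'_def\<close>)
  have "\<forall>\<^sub>F i in sequentially. \<Phi> (s i, p) \<notin> K"
    if p: "p \<in> U" and s: "\<forall>i. s i \<in> action_domain \<Omega>' p"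
      and \<gamma>: "\<gamma> \<in> frontier (action_domain \<Omega>' p)" "s \<longlonglongrightarrow> \<gamma>" and K: "compact K" "K \<subseteq> U"
    for p s \<gamma> K
  proof (rule ccontr)
    assume "\<not> ?thesis"
    then have "\<exists>\<^sub>F i in sequentially. \<Phi> (s i, p) \<in> K" by (simp add: not_eventually)
    then have "infinite {i. \<Phi> (s i, p) \<in> K}" by (simp add: cofinite_eq_sequentially[symmetric] frequently_cofinite)
    then obtain r :: "nat \<Rightarrow> nat" where r: "strict_mono r" "\<And>i. \<Phi> (s (r i), p) \<in> K"
      using infinite_enumerate[of "{i. \<Phi> (s i, p) \<in> K}"] by blast
    then obtain q r' where r': "q \<in> K" "strict_mono r'" "((\<lambda>i. \<Phi> (s (r i), p)) \<circ> r') \<longlonglongrightarrow> q"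
      using K(1)[unfolded compact_def, rule_format, of "\<lambda>i. \<Phi> (s (r i), p)"] by metis
    have dom: "action_domain \<Omega>' p = connected_component_set (V p) 0"
      using p by (auto simp: action_domain_def \<Omega>'_def)
    define \<sigma> where "\<sigma> i = s (r (r' i))" for i
    have \<sigma>: "\<sigma> \<longlonglongrightarrow> \<gamma>" "(\<lambda>i. \<Phi> (\<sigma> i, p)) \<longlonglongrightarrow> q"
      using LIMSEQ_subseq_LIMSEQ[OF \<gamma>(2) strict_mono_o[OF r(1) r'(2)]] r'(3)
      by (simp_all add: \<sigma>_def[abs_def] o_def)
    have \<sigma>O: "(\<sigma> i, p) \<in> \<Omega>" for i
      using s sub by (auto simp: \<sigma>_def action_domain_def R_def)
    have "q \<in> U" using r'(1) K(2) by auto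
    then have \<gamma>O: "(\<gamma>, p) \<in> \<Omega>" using clos \<sigma>O \<sigma> by blast
    have "(\<lambda>i. \<Phi> (\<sigma> i, p)) \<longlonglongrightarrow> \<Phi> (\<gamma>, p)"
      by (rule isCont_tendsto_compose[OF cont[OF \<gamma>O]]) (intro tendsto_intros \<sigma>(1))
    then have "\<Phi> (\<gamma>, p) = q" using \<sigma>(2) LIMSEQ_unique by blast
    then have "\<gamma> \<in> V p" using \<gamma>O \<open>q \<in> U\<close> by (simp add: V_def)
    then obtain e where e: "e > 0" "ball \<gamma> e \<subseteq> V p" using openV[OF p] open_contains_ball by blast
    obtain i where "\<sigma> i \<in> ball \<gamma> e"
      using tendstoD[OF \<sigma>(1) e(1)] eventually_happens'[OF sequentially_bot]
      by (auto simp: dist_commute)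
    then have "connected_component (V p) (\<sigma> i) \<gamma>"
      unfolding connected_component_def
      by (intro exI[of _ "ball \<gamma> e"]) (use e in auto)
    moreover have "connected_component (V p) 0 (\<sigma> i)"
      using s dom by (auto simp: \<sigma>_def)
    ultimately have "\<gamma> \<in> action_domain \<Omega>' p"
      unfolding dom using connected_component_trans by blast
    moreover have "open (action_domain \<Omega>' p)"
      unfolding dom by (rule open_connected_component[OF openV[OF p]])
    ultimately show False using \<gamma>(1) by (simp add: frontier_def interior_open)
  qed
  with local have "maximal_local_action U \<Omega>' \<Phi>"
    unfolding maximal_local_action_def by blast
  then show ?thesis by (simp add: \<Omega>'_def V_def)
qed

section \<open>Commuting fields\<close>

lemma scaleC_zero_left [simp]: "0 *\<^sub>C v = (0::'a::complex_normed_space)"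
  using scaleC_add_left[of 0 0 v] by simp

lemma scaleC_one [simp]: "1 *\<^sub>C v = (v::'a::complex_normed_space)"
  using scaleC_of_real[of 1 v] by simp

text \<open>
  Brackets of combinations of \<open>X\<close> and \<open>Y\<close> with constant coefficients are multiples of \<open>[X, Y]\<close>,
  so closing up under brackets adds nothing to the linear span.
\<close>

lemma generated_lie_algebra_commuting:
  fixes X Y :: "'m::complex_normed_space \<Rightarrow> 'm"
  assumes U: "open U"
    and cdiff: "\<And>p. p \<in> U \<Longrightarrow> X cdifferentiable_at p" "\<And>p. p \<in> U \<Longrightarrow> Y cdifferentiable_at p"
    and comm: "\<And>p. p \<in> U \<Longrightarrow> lie_bracket X Y p = 0"
  shows "generated_lie_algebra U {X, Y} =
    range (\<lambda>v. restrict_field U (\<lambda>p. fst v *\<^sub>C X p + snd v *\<^sub>C Y p))"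
proof -
  define V where "V v = restrict_field U (\<lambda>p. fst v *\<^sub>C X p + snd v *\<^sub>C Y p)"
    for v :: "complex \<times> complex"
  have V_zero: "V 0 = (\<lambda>p. 0)"
    by (auto simp: V_def restrict_field_def)
  have V_add: "V v p + V v' p = V (v + v') p" for v v' p
    by (simp add: V_def restrict_field_def scaleC_add_left algebra_simps)
  have V_scale: "c *\<^sub>C V v p = V (c *\<^sub>C v) p" for c v p
    by (simp add: V_def restrict_field_def scaleC_prod_def scaleC_complex_def scaleC_add_right scaleC_scaleC)
  have gen: "restrict_field U X = V (1, 0)" "restrict_field U Y = V (0, 1)"
    by (auto simp: V_def restrict_field_def)
  have V_bracket: "restrict_field U (lie_bracket (V v) (V v')) = V 0" for v v'
  proof (rule ext)
    fix p
    show "restrict_field U (lie_bracket (V v) (V v')) p = V 0 p"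
    proof (cases "p \<in> U")
      case True
      from cdiff[OF True] obtain DX DY where
        DX: "(X has_derivative DX) (at p)" "\<And>c v. DX (c *\<^sub>C v) = c *\<^sub>C DX v" and
        DY: "(Y has_derivative DY) (at p)" "\<And>c v. DY (c *\<^sub>C v) = c *\<^sub>C DY v"
        unfolding cdifferentiable_at_def by blast
      note addD = linear_add[OF has_derivative_linear[OF DX(1)]]
        linear_add[OF has_derivative_linear[OF DY(1)]]
      have bl: "bounded_linear (\<lambda>x::'m. c *\<^sub>C x)" for c
      proof (rule bounded_linear_intro[where K = "cmod c"])
        show "c *\<^sub>C (r *\<^sub>R x) = r *\<^sub>R (c *\<^sub>C x)" for r and x :: 'm
          by (simp add: scaleC_scaleC mult.commute flip: scaleC_of_real)
      qed (simp_all add: scaleC_add_right norm_scaleC mult.commute)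
      have eq: "lie_bracket X Y p = DY (X p) - DX (Y p)"
        by (simp add: lie_bracket_def frechet_derivative_at[OF DX(1), symmetric]
            frechet_derivative_at[OF DY(1), symmetric])
      have D: "(V v has_derivative (\<lambda>h. fst v *\<^sub>C DX h + snd v *\<^sub>C DY h)) (at p)" for v
        unfolding V_def restrict_field_def
        by (rule has_derivative_transform_within_open[OF _ U True, where
              f = "\<lambda>p. fst v *\<^sub>C X p + snd v *\<^sub>C Y p"])
          (auto intro!: has_derivative_add bounded_linear.has_derivative[OF bl] DX(1) DY(1))
      have "fst v' *\<^sub>C DX (V v p) + snd v' *\<^sub>C DY (V v p) =
            fst v *\<^sub>C DX (V v' p) + snd v *\<^sub>C DY (V v' p)"
        using True comm[OF True] eq
        by (simp add: V_def restrict_field_def addD DX(2) DY(2) scaleC_add_right scaleC_scaleC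
            mult.commute add_ac)
      then show ?thesis
        using True V_zero by (simp add: restrict_field_def lie_bracket_def
            frechet_derivative_at[OF D, symmetric])
    qed (simp add: restrict_field_def V_zero)
  qed
  have "Z \<in> range V" if "Z \<in> generated_lie_algebra U {X, Y}" for Z
    using that
  proof induction
    case (generator X') then show ?case using gen by auto
  next
    case zero then show ?case using V_zero by (metis rangeI)
  next
    case (add Z Z')
    then obtain v v' where "Z = V v" "Z' = V v'" by auto
    then have "(\<lambda>p. Z p + Z' p) = V (v + v')" using V_add by auto
    then show ?case by auto
  next
    case (scale Z c)
    then obtain v where "Z = V v" by auto
    then have "(\<lambda>p. c *\<^sub>C Z p) = V (c *\<^sub>C v)" using V_scale by auto
    then show ?case by auto
  next
    case (bracket Z Z')
    then show ?case using V_bracket by auto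
  qed
  moreover have "V v \<in> generated_lie_algebra U {X, Y}" for v
  proof -
    have "V (1, 0) \<in> generated_lie_algebra U {X, Y}" "V (0, 1) \<in> generated_lie_algebra U {X, Y}"
      unfolding gen[symmetric] by (auto intro: generated_lie_algebra.generator)
    then have "(\<lambda>p. fst v *\<^sub>C V (1, 0) p + snd v *\<^sub>C V (0, 1) p) \<in> generated_lie_algebra U {X, Y}"
      by (intro generated_lie_algebra.add generated_lie_algebra.scale)
    also have "(\<lambda>p. fst v *\<^sub>C V (1, 0) p + snd v *\<^sub>C V (0, 1) p) = V v"
      by (auto simp: V_def restrict_field_def)
    finally show ?thesis .
  qed
  ultimately show ?thesis unfolding V_def[abs_def, symmetric] by blast
qed

text \<open>
  The derivative is evaluated only on vectors \<open>(x u, y v)\<close>, that is on the logarithmic fields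
  \<open>u x \<partial>/\<partial>x + v y \<partial>/\<partial>y\<close>, for which every monomial is an eigenfunction when \<open>u\<close> and \<open>v\<close> are constant.
\<close>

lemma monomial_log_derivative:
  fixes x y :: complex
  obtains d where "((\<lambda>p. fst p ^ i * snd p ^ j) has_derivative d) (at (x, y))"
    "\<And>u v. d (x * u, y * v) = x ^ i * y ^ j * (of_nat i * u + of_nat j * v)"
proof
  show "((\<lambda>p. fst p ^ i * snd p ^ j) has_derivative
      (\<lambda>v. x ^ i * (of_nat j * snd v * y ^ (j - 1)) + of_nat i * fst v * x ^ (i - 1) * y ^ j)) (at (x, y))"
    by (rule derivative_eq_intros refl | simp)+
  show "x ^ i * (of_nat j * snd (x * u, y * v) * y ^ (j - 1)) + of_nat i * fst (x * u, y * v) * x ^ (i - 1) * y ^ j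
     = x ^ i * y ^ j * (of_nat i * u + of_nat j * v)" for u v
    by (cases i; cases j) (auto simp: algebra_simps)
qed

lemma has_derivative_field_compose:
  fixes h :: "complex \<Rightarrow> complex"
  assumes "(F has_derivative D) (at p)" "(h has_field_derivative h') (at (F p))"
  shows "((\<lambda>x. h (F x)) has_derivative (\<lambda>v. h' * D v)) (at p)"
  using has_derivative_compose[OF assms(1), of h "(*) h'"] assms(2) by (simp add: has_field_derivative_def)

text \<open>
  Writing \<open>z = x^n y^m\<close> and \<open>w = x^a y^b\<close>, the bracket vanishes because of the three relations
  \<open>X z = 0\<close>, \<open>X F = \<epsilon> w F\<close> and \<open>m Y w = \<epsilon> g(z) w F\<close>.  The second one uses that the
  reduced exponents \<open>(\<alpha>, \<beta>)\<close> have the same determinant \<open>\<epsilon>\<close> against \<open>(n, m)\<close> as \<open>(a, b)\<close>.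
\<close>

lemma fields_commute:
  fixes a b m n \<alpha> \<beta> :: nat and \<epsilon> :: complex
  assumes F: "\<And>x y. (x, y) \<in> U \<Longrightarrow> F (x, y) = x ^ \<alpha> * y ^ \<beta> * f (x ^ n * y ^ m)"
    and U: "open U" "(x, y) \<in> U" and m: "m > 0"
    and \<epsilon>: "of_nat (a * m) - of_nat (b * n) = \<epsilon>" "of_nat (\<alpha> * m) - of_nat (\<beta> * n) = \<epsilon>"
    and f: "f field_differentiable (at (x ^ n * y ^ m))" and g: "g field_differentiable (at (x ^ n * y ^ m))"
  shows "field_X a b m n cdifferentiable_at (x, y)"
    and "field_Y a b m n g F cdifferentiable_at (x, y)"
    and "lie_bracket (field_X a b m n) (field_Y a b m n g F) (x, y) = 0"
proof -
  define z where "z = x ^ n * y ^ m"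
  define w where "w = x ^ a * y ^ b"
  obtain f' g' where f': "(f has_field_derivative f') (at z)" and g': "(g has_field_derivative g') (at z)"
    using f g by (auto simp: field_differentiable_def z_def)
  define X where "X = (\<lambda>p::complex \<times> complex. (fst p * (of_nat m * (fst p ^ a * snd p ^ b)), snd p * (- of_nat n * (fst p ^ a * snd p ^ b))))"
  define F0 where "F0 = (\<lambda>p::complex \<times> complex. fst p ^ \<alpha> * snd p ^ \<beta> * f (fst p ^ n * snd p ^ m))"
  define Y where "Y = (\<lambda>p::complex \<times> complex. 
     (fst p * (g (fst p ^ n * snd p ^ m) * (- of_nat (b * m) + F0 p)), 
      snd p * (g (fst p ^ n * snd p ^ m) * (of_nat (a * m) - of_nat n / of_nat m * F0 p))))"
  have X: "field_X a b m n = X" by (auto simp: field_X_def X_def)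
  have Y: "field_Y a b m n g F p = Y p" if "p \<in> U" for p
    using that F by (cases p) (simp add: field_Y_def Y_def F0_def)
  have ff: "f field_differentiable (at (fst (x, y) ^ n * snd (x, y) ^ m))"
     "g field_differentiable (at (fst (x, y) ^ n * snd (x, y) ^ m))" using f g by auto
  have cX: "X cdifferentiable_at (x, y)" unfolding X_def
    by (intro cdifferentiable_intros)
  have cY: "Y cdifferentiable_at (x, y)" unfolding Y_def F0_def
    by (intro cdifferentiable_intros cdifferentiable_field_compose[of "\<lambda>p. fst p ^ n * snd p ^ m"] ff)
  show "field_X a b m n cdifferentiable_at (x, y)" using cX X by simp
  have tr: "(field_Y a b m n g F has_derivative D) (at (x, y))" if "(Y has_derivative D) (at (x, y))" for D
    by (rule has_derivative_transform_within_open[OF that U]) (simp add: Y)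
  then show "field_Y a b m n g F cdifferentiable_at (x, y)"
    using cY unfolding cdifferentiable_at_def by blast
  obtain dz where dz: "((\<lambda>p. fst p ^ n * snd p ^ m) has_derivative dz) (at (x, y))"
    "\<And>u v. dz (x * u, y * v) = z * (of_nat n * u + of_nat m * v)"
    by (rule monomial_log_derivative[of n m x y, folded z_def]) (rule that)
  obtain dw where dw: "((\<lambda>p. fst p ^ a * snd p ^ b) has_derivative dw) (at (x, y))"
    "\<And>u v. dw (x * u, y * v) = w * (of_nat a * u + of_nat b * v)"
    by (rule monomial_log_derivative[of a b x y, folded w_def]) (rule that)
  obtain d\<mu> where d\<mu>: "((\<lambda>p. fst p ^ \<alpha> * snd p ^ \<beta>) has_derivative d\<mu>) (at (x, y))"
    "\<And>u v. d\<mu> (x * u, y * v) = x ^ \<alpha> * y ^ \<beta> * (of_nat \<alpha> * u + of_nat \<beta> * v)"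
    by (rule monomial_log_derivative[of \<alpha> \<beta> x y]) (rule that)
  have df: "((\<lambda>p. f (fst p ^ n * snd p ^ m)) has_derivative (\<lambda>v. f' * dz v)) (at (x, y))"
    by (rule has_derivative_field_compose[OF dz(1)]) (use f' in \<open>simp add: z_def\<close>)
  have dg: "((\<lambda>p. g (fst p ^ n * snd p ^ m)) has_derivative (\<lambda>v. g' * dz v)) (at (x, y))"
    by (rule has_derivative_field_compose[OF dz(1)]) (use g' in \<open>simp add: z_def\<close>)
  define dF where "dF v = d\<mu> v * f z + x ^ \<alpha> * y ^ \<beta> * (f' * dz v)" for v
  have dF: "(F0 has_derivative dF) (at (x, y))"
    unfolding F0_def dF_def[abs_def]
    by (rule has_derivative_eq_rhs[OF has_derivative_mult[OF d\<mu>(1) df]]) (auto simp: z_def)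
  define P where "P = g z * (- of_nat (b * m) + F0 (x, y))"
  define R where "R = g z * (of_nat (a * m) - of_nat n / of_nat m * F0 (x, y))"
  define DX where "DX v = (fst v * (of_nat m * w) + x * (of_nat m * dw v), snd v * (- of_nat n * w) + y * (- of_nat n * dw v))" for v
  define DY where "DY v = (fst v * P + x * (g' * dz v * (- of_nat (b * m) + F0 (x, y)) + g z * dF v),
     snd v * R + y * (g' * dz v * (of_nat (a * m) - of_nat n / of_nat m * F0 (x, y)) - g z * (of_nat n / of_nat m * dF v)))" for v
  have DX: "(X has_derivative DX) (at (x, y))"
    unfolding X_def DX_def[abs_def]
    by (rule derivative_eq_intros dw(1) refl | simp add: w_def algebra_simps)+
  have DY: "(Y has_derivative DY) (at (x, y))"
    unfolding Y_def DY_def[abs_def]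
    by (rule derivative_eq_intros dg dF refl | simp add: P_def R_def z_def algebra_simps)+
  have m0: "of_nat m \<noteq> (0::complex)" using m by simp
  have Xp: "X (x, y) = (x * (of_nat m * w), y * (- of_nat n * w))" by (simp add: X_def w_def)
  have Yp: "Y (x, y) = (x * P, y * R)" by (simp add: Y_def P_def R_def z_def)
  have 1: "dz (X (x, y)) = 0" unfolding Xp dz(2) by simp
  have 2: "dF (X (x, y)) = \<epsilon> * w * F0 (x, y)"
    unfolding dF_def 1 unfolding Xp d\<mu>(2) F0_def \<epsilon>(2)[symmetric] by (simp add: z_def algebra_simps)
  have 3: "of_nat m * dw (Y (x, y)) = w * g z * F0 (x, y) * \<epsilon>"
    unfolding Yp dw(2) P_def R_def \<epsilon>(1)[symmetric] using m0 by (simp add: field_simps)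
  then have 3: "dw (Y (x, y)) = w * g z * F0 (x, y) * \<epsilon> / of_nat m"
    using m0 by (simp add: field_simps)
  have "DY (X (x, y)) = DX (Y (x, y))"
    unfolding DX_def DY_def 1 2 3 unfolding Xp Yp using m0 by (simp add: field_simps)
  then show "lie_bracket (field_X a b m n) (field_Y a b m n g F) (x, y) = 0"
    unfolding lie_bracket_def X frechet_derivative_at[OF DX, symmetric]
      frechet_derivative_at[OF tr[OF DY], symmetric] Y[OF U(2)] by simp
qed

section \<open>Scaling flows in one variable\<close>

text \<open>
  The flow \<open>z \<mapsto> z E(t, z)\<close> of the field \<open>z v(z) \<partial>/\<partial>z\<close>, which fixes \<open>0\<close>, on the neighbourhood \<open>B\<close> of \<open>0\<close>.
  The factor \<open>E\<close> is recorded rather than the flow itself, because powers of \<open>E\<close> multiply the coordinates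
  \<open>x\<close> and \<open>y\<close>, also over \<open>z = 0\<close>, where \<open>E\<close> is not determined by the flow.  The assumption
  \<open>maximal\<close> expresses that time can only end when the point leaves \<open>B\<close>.
\<close>

locale scaling_flow =
  fixes B :: "complex set" and Q :: "(complex \<times> complex) set"
    and E :: "complex \<times> complex \<Rightarrow> complex" and v :: "complex \<Rightarrow> complex"
  assumes open_base: "open B" and zero_in_base: "0 \<in> B"
    and open_domain: "open Q"
    and domain: "\<And>t z. (t, z) \<in> Q \<Longrightarrow> z \<in> B \<and> E (t, z) \<noteq> 0 \<and> z * E (t, z) \<in> B"
    and start: "\<And>z. z \<in> B \<Longrightarrow> (0, z) \<in> Q \<and> E (0, z) = 1"
    and cocycle: "\<And>t t' z. (t, z) \<in> Q \<Longrightarrow> (t', z * E (t, z)) \<in> Q \<Longrightarrow> (t' + t, z) \<in> Q \<Longrightarrow>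
                    E (t' + t, z) = E (t, z) * E (t', z * E (t, z))"
    and holomorphic: "\<And>q. q \<in> Q \<Longrightarrow> E cdifferentiable_at q"
    and maximal: "\<And>z \<tau> t z'. z \<in> B \<Longrightarrow> (\<And>i::nat. (\<tau> i, z) \<in> Q) \<Longrightarrow> \<tau> \<longlonglongrightarrow> t \<Longrightarrow>
                    (\<lambda>i. z * E (\<tau> i, z)) \<longlonglongrightarrow> z' \<Longrightarrow> z' \<in> B \<Longrightarrow> (t, z) \<in> Q"
    and generator: "\<And>z. z \<in> B \<Longrightarrow> ((\<lambda>t. E (t, z)) has_field_derivative v z) (at 0)"

section \<open>The action in closed form\<close>

lemma monomial_of_scaled:
  fixes x y e d :: complex
  assumes "e \<noteq> 0" "d \<noteq> 0"
  shows "(x * e powi p * d powi q) ^ i * (y * e powi p' * d powi q') ^ j =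
    x ^ i * y ^ j * e powi (p * int i + p' * int j) * d powi (q * int i + q' * int j)"
proof -
  have "(u powi r) ^ k = u powi (r * int k)" for u :: complex and r k
    by (metis power_int_mult power_int_of_nat)
  then show ?thesis using assms by (simp add: power_mult_distrib power_int_add)
qed

text \<open>
  The function \<open>f\<close> here is the holomorphic numerator: the coefficient of the field \<open>Y\<close> is \<open>f(z)/z^k\<close>.
  The assumption \<open>primitive\<close> states that \<open>A/z^k\<close>, corrected by \<open>c t\<close>, integrates the rate
  \<open>(\<epsilon>/m) g(z) f(z)/z^k\<close> at which \<open>Y\<close> moves \<open>-1/w\<close>: along the flow of \<open>z\<close>, the function \<open>A/z^k\<close> has
  derivative \<open>\<epsilon> m g(z) (z A'(z) - k A(z))/z^k\<close>.
\<close>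

locale monomial_flow = scaling_flow B Q E "\<lambda>z. of_int \<epsilon> * of_nat m * g z"
  for a b m n k \<alpha> \<beta> :: nat and \<epsilon> :: int and c :: complex and A f g :: "complex \<Rightarrow> complex"
    and B Q E +
  assumes pos: "a > 0" "b > 0" "m > 0" "n > 0"
    and unimodular: "\<epsilon> \<in> {-1, 1}" "int a * int m - int b * int n = \<epsilon>"
    and exponents: "a = \<alpha> + k * n" "b = \<beta> + k * m"
    and f_holo: "f holomorphic_on B" and g_holo: "g holomorphic_on B" and A_holo: "A holomorphic_on B"
    and primitive: "\<And>z. z \<in> B \<Longrightarrow> c * z ^ k + of_int \<epsilon> * of_nat m * g z * (z * deriv A z - of_nat k * A z) =
                      of_int \<epsilon> * g z * f z / of_nat m"
    and g_nonzero: "\<And>z. z \<in> B \<Longrightarrow> z \<noteq> 0 \<Longrightarrow> g z \<noteq> 0"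
begin

text \<open>
  The time integral of \<open>(\<epsilon>/m) g f/z^k\<close> along the orbit of \<open>z\<close> is \<open>c t + A(z')/z'^k - A(z)/z^k\<close> with
  \<open>z' = z E\<close>.  Multiplying it by \<open>z^k\<close> leaves this function, without a singularity at \<open>z = 0\<close>.
\<close>

definition \<kappa> :: "complex \<times> complex \<Rightarrow> complex" where
  "\<kappa> q = c * fst q * snd q ^ k + A (snd q * E q) / E q ^ k - A (snd q)"

text \<open>
  The ratio of the old to the new value of \<open>x^a y^b\<close>, as a consequence of the translation
  of \<open>x^{-a} y^{-b}\<close>.
\<close>

definition \<Delta> :: "(complex \<times> complex) \<times> (complex \<times> complex) \<Rightarrow> complex" where
  "\<Delta> = (\<lambda>((s, t), (x, y)).
     1 - of_int \<epsilon> * s * (x ^ a * y ^ b) - x ^ \<alpha> * y ^ \<beta> * \<kappa> (t, x ^ n * y ^ m))"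

text \<open>
  The exponents come from inverting the monomial map: \<open>x = z^{-\<epsilon>b} w^{\<epsilon>m}\<close> and \<open>y = z^{\<epsilon>a} w^{-\<epsilon>n}\<close>,
  where \<open>z\<close> is multiplied by \<open>E\<close> and \<open>w\<close> is divided by \<open>\<Delta>\<close>.
\<close>

definition \<Phi> :: "(complex \<times> complex) \<times> (complex \<times> complex) \<Rightarrow> complex \<times> complex" where
  "\<Phi> = (\<lambda>((s, t), (x, y)).
     (x * E (t, x ^ n * y ^ m) powi (- \<epsilon> * int b) * \<Delta> ((s, t), (x, y)) powi (- \<epsilon> * int m),
      y * E (t, x ^ n * y ^ m) powi (\<epsilon> * int a) * \<Delta> ((s, t), (x, y)) powi (\<epsilon> * int n)))"

definition \<Omega> :: "((complex \<times> complex) \<times> (complex \<times> complex)) set" where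
  "\<Omega> = {((s, t), (x, y)). (t, x ^ n * y ^ m) \<in> Q \<and> \<Delta> ((s, t), (x, y)) \<noteq> 0}"

lemma eps_square: "\<epsilon> * \<epsilon> = 1"
  using unimodular by auto

lemma reduced_unimodular: "int \<alpha> * int m - int \<beta> * int n = \<epsilon>"
  using unimodular(2) exponents by (simp add: algebra_simps)

text \<open>The terms at the intermediate point cancel; the power of \<open>E\<close> rescales \<open>z^k\<close> to that point.\<close>

lemma \<kappa>_cocycle:
  assumes "(t, z) \<in> Q" "(t', z * E (t, z)) \<in> Q" "(t' + t, z) \<in> Q"
  shows "\<kappa> (t' + t, z) = \<kappa> (t, z) + \<kappa> (t', z * E (t, z)) / E (t, z) ^ k"
proof -
  have "E (t, z) \<noteq> 0" "E (t', z * E (t, z)) \<noteq> 0" using domain assms by blast+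
  then show ?thesis unfolding \<kappa>_def fst_conv snd_conv cocycle[OF assms]
    by (simp add: field_simps power_mult_distrib)
qed

lemma \<kappa>_start: "z \<in> B \<Longrightarrow> \<kappa> (0, z) = 0"
  using start by (simp add: \<kappa>_def)

lemma \<kappa>_holomorphic:
  assumes "q \<in> Q" shows "\<kappa> cdifferentiable_at q"
proof -
  obtain t z where q: "q = (t, z)" by fastforce
  have "A field_differentiable at (snd q)" "A field_differentiable at (snd q * E q)"
    using domain assms A_holo open_base
    by (auto simp: q intro: holomorphic_on_imp_differentiable_at)
  then show ?thesis unfolding \<kappa>_def[abs_def]
    using domain assms
    by (intro cdifferentiable_intros holomorphic[OF assms] cdifferentiable_field_compose[where h = A])
      (auto simp: q)
qed

lemma \<kappa>_generator:
  assumes "z \<in> B"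
  shows "((\<lambda>t. \<kappa> (t, z)) has_field_derivative of_int \<epsilon> * g z * f z / of_nat m) (at 0)"
proof -
  have "(A has_field_derivative deriv A z) (at z)"
    using assms A_holo open_base by (simp add: holomorphic_derivI)
  then have A: "(A has_field_derivative deriv A z) (at (z * E (0, z)))"
    using start[OF assms] by simp
  note E0 = conjunct2[OF start[OF assms]]
  define v where "v = of_int \<epsilon> * of_nat m * g z"
  note E' = generator[OF assms, folded v_def]
  have A': "((\<lambda>t. A (z * E (t, z))) has_field_derivative deriv A z * (z * v)) (at 0)"
    by (rule DERIV_chain2[OF A DERIV_cmult[OF E']])
  have P: "((\<lambda>t. E (t, z) ^ k) has_field_derivative of_nat k * v) (at 0)"
    using DERIV_power[OF E', of k] E0 by simp
  have "((\<lambda>t. A (z * E (t, z)) / E (t, z) ^ k) has_field_derivative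
      deriv A z * (z * v) - A z * (of_nat k * v)) (at 0)"
    using DERIV_divide[OF A' P] E0 by simp
  moreover have "((\<lambda>t. c * t * z ^ k) has_field_derivative c * z ^ k) (at 0)"
    using DERIV_cmult_right[OF DERIV_cmult[OF DERIV_ident]] by fastforce
  ultimately have "((\<lambda>t. \<kappa> (t, z)) has_field_derivative
     c * z ^ k + (deriv A z * (z * v) - A z * (of_nat k * v)) - 0) (at 0)"
    unfolding \<kappa>_def fst_conv snd_conv by (intro DERIV_add DERIV_diff DERIV_const)
  also have "c * z ^ k + (deriv A z * (z * v) - A z * (of_nat k * v)) - 0
    = of_int \<epsilon> * g z * f z / of_nat m"
    using primitive[OF assms] by (simp add: v_def algebra_simps)
  finally show ?thesis .
qed

text \<open>
  Three instances of \<open>monomial_of_scaled\<close>.  In each one the exponents of \<open>E\<close> and \<open>\<Delta>\<close> are determinants of two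
  of the vectors \<open>(n, m)\<close>, \<open>(a, b)\<close> and \<open>(\<alpha>, \<beta>) = (a, b) - k (n, m)\<close>, up to a factor \<open>\<plusminus>\<epsilon>\<close>.
\<close>

lemma \<Phi>_monomials:
  assumes "((s, t), (x, y)) \<in> \<Omega>" "\<Phi> ((s, t), (x, y)) = (x', y')"
  shows "x' ^ n * y' ^ m = x ^ n * y ^ m * E (t, x ^ n * y ^ m)"
    and "x' ^ a * y' ^ b = x ^ a * y ^ b / \<Delta> ((s, t), (x, y))"
    and "x' ^ \<alpha> * y' ^ \<beta> = x ^ \<alpha> * y ^ \<beta> / (E (t, x ^ n * y ^ m) ^ k * \<Delta> ((s, t), (x, y)))"
proof -
  define z e d where "z = x ^ n * y ^ m" and "e = E (t, z)" and "d = \<Delta> ((s, t), (x, y))"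
  have nz: "e \<noteq> 0" "d \<noteq> 0" using assms(1) domain by (auto simp: \<Omega>_def e_def d_def z_def)
  have x': "x' = x * e powi (- \<epsilon> * int b) * d powi (- \<epsilon> * int m)"
    and y': "y' = y * e powi (\<epsilon> * int a) * d powi (\<epsilon> * int n)"
    using assms(2) by (auto simp: \<Phi>_def e_def d_def z_def)
  have 1: "- \<epsilon> * int b * int n + \<epsilon> * int a * int m = 1"
  proof -
    have "- \<epsilon> * int b * int n + \<epsilon> * int a * int m = \<epsilon> * (int a * int m - int b * int n)"
      by (simp add: algebra_simps)
    then show ?thesis using unimodular(2) eps_square by simp
  qed
  have 2: "- \<epsilon> * int m * int a + \<epsilon> * int n * int b = - 1"
    using 1 by (simp add: algebra_simps)
  have 3: "- \<epsilon> * int b * int \<alpha> + \<epsilon> * int a * int \<beta> = - int k"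
  proof -
    have "- \<epsilon> * int b * int \<alpha> + \<epsilon> * int a * int \<beta> = - (\<epsilon> * (int a * int m - int b * int n)) * int k"
      unfolding exponents by (simp add: algebra_simps)
    then show ?thesis using unimodular(2) eps_square by simp
  qed
  have 4: "- \<epsilon> * int m * int \<alpha> + \<epsilon> * int n * int \<beta> = - 1"
  proof -
    have "- \<epsilon> * int m * int \<alpha> + \<epsilon> * int n * int \<beta> = - (\<epsilon> * (int \<alpha> * int m - int \<beta> * int n))"
      by (simp add: algebra_simps)
    then show ?thesis using reduced_unimodular eps_square by simp
  qed
  show "x' ^ n * y' ^ m = x ^ n * y ^ m * E (t, x ^ n * y ^ m)"
    unfolding x' y' monomial_of_scaled[OF nz] 1 by (simp add: e_def z_def)
  show "x' ^ a * y' ^ b = x ^ a * y ^ b / \<Delta> ((s, t), (x, y))"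
    unfolding x' y' monomial_of_scaled[OF nz] 2
    by (simp add: d_def power_int_minus divide_inverse)
  show "x' ^ \<alpha> * y' ^ \<beta> = x ^ \<alpha> * y ^ \<beta> / (E (t, x ^ n * y ^ m) ^ k * \<Delta> ((s, t), (x, y)))"
    unfolding x' y' monomial_of_scaled[OF nz] 3 4 using nz
    by (simp add: d_def e_def z_def power_int_minus divide_inverse)
qed

text \<open>
  Both coordinates are monomials in \<open>E\<close> and \<open>\<Delta>\<close>, so it suffices that these two factors are
  multiplicative along the action.  For \<open>E\<close> this is the cocycle rule of the flow.  For \<open>\<Delta>\<close> it
  follows from the behaviour of \<open>x^a y^b\<close> and \<open>x^\<alpha> y^\<beta>\<close>, both of which are divided by \<open>\<Delta>\<close>, so
  that multiplying by \<open>\<Delta>\<close> cancels the denominators.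
\<close>

lemma \<Phi>_action:
  assumes "(g2, p) \<in> \<Omega>" "(g1, \<Phi> (g2, p)) \<in> \<Omega>" "(g1 + g2, p) \<in> \<Omega>"
  shows "\<Phi> (g1 + g2, p) = \<Phi> (g1, \<Phi> (g2, p))"
proof -
  obtain s t s' t' x y where eq: "g2 = (s, t)" "g1 = (s', t')" "p = (x, y)" by (metis surj_pair)
  obtain x1 y1 where p1: "\<Phi> ((s, t), (x, y)) = (x1, y1)" by fastforce
  define z e d where "z = x ^ n * y ^ m" and "e = E (t, z)" and "d = \<Delta> ((s, t), (x, y))"
  define e' d' where "e' = E (t', z * e)" and "d' = \<Delta> ((s', t'), (x1, y1))"
  have in\<Omega>: "((s, t), (x, y)) \<in> \<Omega>" "((s', t'), (x1, y1)) \<in> \<Omega>" "((s' + s, t' + t), (x, y)) \<in> \<Omega>"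
    using assms by (auto simp: eq p1)
  note mono = \<Phi>_monomials[OF in\<Omega>(1) p1, folded z_def, folded e_def d_def]
  have Q: "(t, z) \<in> Q" "(t', z * e) \<in> Q" "(t' + t, z) \<in> Q"
    using in\<Omega> mono(1) by (auto simp: \<Omega>_def z_def e_def)
  have nz: "e \<noteq> 0" "d \<noteq> 0" using in\<Omega>(1) domain by (auto simp: \<Omega>_def e_def d_def z_def)
  have E: "E (t' + t, z) = e * e'"
    using cocycle Q by (simp add: e_def e'_def)
  have D: "\<Delta> ((s' + s, t' + t), (x, y)) = d * d'"
  proof -
    have "d * d' = d - of_int \<epsilon> * s' * (x ^ a * y ^ b) - x ^ \<alpha> * y ^ \<beta> * \<kappa> (t', z * e) / e ^ k"
      unfolding d'_def \<Delta>_def prod.case mono using nz by (simp add: field_simps)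
    also have "\<dots> = 1 - of_int \<epsilon> * (s' + s) * (x ^ a * y ^ b) -
        x ^ \<alpha> * y ^ \<beta> * (\<kappa> (t, z) + \<kappa> (t', z * e) / e ^ k)"
      unfolding d_def \<Delta>_def prod.case z_def by (simp add: algebra_simps)
    also have "\<kappa> (t, z) + \<kappa> (t', z * e) / e ^ k = \<kappa> (t' + t, z)"
      using \<kappa>_cocycle Q by (simp add: e_def)
    finally show ?thesis by (simp add: \<Delta>_def z_def)
  qed
  have x1: "x1 = x * e powi (- \<epsilon> * int b) * d powi (- \<epsilon> * int m)"
    and y1: "y1 = y * e powi (\<epsilon> * int a) * d powi (\<epsilon> * int n)"
    using p1 by (auto simp: \<Phi>_def e_def d_def z_def)
  have "\<Phi> ((s' + s, t' + t), (x, y)) =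
     (x * (e * e') powi (- \<epsilon> * int b) * (d * d') powi (- \<epsilon> * int m),
      y * (e * e') powi (\<epsilon> * int a) * (d * d') powi (\<epsilon> * int n))"
    by (simp add: \<Phi>_def D E z_def[symmetric])
  also have "\<dots> = (x1 * e' powi (- \<epsilon> * int b) * d' powi (- \<epsilon> * int m),
      y1 * e' powi (\<epsilon> * int a) * d' powi (\<epsilon> * int n))"
    by (simp add: x1 y1 power_int_mult_distrib mult_ac)
  also have "\<dots> = \<Phi> ((s', t'), (x1, y1))"
    unfolding \<Phi>_def prod.case mono(1) e'_def d'_def ..
  finally show ?thesis by (simp add: eq p1)
qed

lemma \<Delta>_holomorphic:
  assumes "(snd (fst q), fst (snd q) ^ n * snd (snd q) ^ m) \<in> Q"
  shows "\<Delta> cdifferentiable_at q"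
  unfolding \<Delta>_def case_prod_beta
  by (intro cdifferentiable_intros
      cdifferentiable_compose[where G = \<kappa> and F = "\<lambda>q. (snd (fst q), fst (snd q) ^ n * snd (snd q) ^ m)"]
      \<kappa>_holomorphic assms)

lemma \<Phi>_holomorphic: "\<Phi> multi_holomorphic_on \<Omega>"
proof -
  define Q' where "Q' = (\<lambda>q :: (complex \<times> complex) \<times> complex \<times> complex.
    (snd (fst q), fst (snd q) ^ n * snd (snd q) ^ m)) -` Q"
  have "open Q'" unfolding Q'_def
    by (intro open_vimage open_domain continuous_intros)
  moreover have "continuous_on Q' \<Delta>"
    by (intro continuous_at_imp_continuous_on ballI cdifferentiable_imp_isCont \<Delta>_holomorphic)
      (simp add: Q'_def)
  ultimately have "open (Q' \<inter> \<Delta> -` (- {0}))"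
    by (intro continuous_open_preimage) auto
  also have "Q' \<inter> \<Delta> -` (- {0}) = \<Omega>"
    by (auto simp: Q'_def \<Omega>_def)
  finally have "open \<Omega>" .
  moreover have "\<Phi> cdifferentiable_at q" if "q \<in> \<Omega>" for q
  proof -
    have q: "(snd (fst q), fst (snd q) ^ n * snd (snd q) ^ m) \<in> Q" "\<Delta> q \<noteq> 0"
      using that by (auto simp: \<Omega>_def)
    have e: "(\<lambda>q. E (snd (fst q), fst (snd q) ^ n * snd (snd q) ^ m)) cdifferentiable_at q"
      by (intro cdifferentiable_compose[where G = E and
            F = "\<lambda>q. (snd (fst q), fst (snd q) ^ n * snd (snd q) ^ m)"]
          cdifferentiable_intros holomorphic q(1))
    have "E (snd (fst q), fst (snd q) ^ n * snd (snd q) ^ m) \<noteq> 0" using domain q(1) by blast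
    then have "(\<lambda>q. (fst (snd q) * E (snd (fst q), fst (snd q) ^ n * snd (snd q) ^ m) powi (- \<epsilon> * int b) * \<Delta> q powi (- \<epsilon> * int m),
       snd (snd q) * E (snd (fst q), fst (snd q) ^ n * snd (snd q) ^ m) powi (\<epsilon> * int a) * \<Delta> q powi (\<epsilon> * int n)))
      cdifferentiable_at q"
      using q by (intro cdifferentiable_intros e \<Delta>_holomorphic)
    then show ?thesis by (simp add: \<Phi>_def case_prod_unfold)
  qed
  ultimately show ?thesis by (simp add: multi_holomorphic_on_iff)
qed

lemma \<Phi>_start:
  assumes "x ^ n * y ^ m \<in> B"
  shows "((0, 0), (x, y)) \<in> \<Omega>" "\<Phi> ((0, 0), (x, y)) = (x, y)"
  using start[OF assms] \<kappa>_start[OF assms] by (auto simp: \<Omega>_def \<Phi>_def \<Delta>_def)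

text \<open>
  Convergence of the orbit makes \<open>z\<close> converge in \<open>B\<close>, so the one-variable flow reaches the limit time.
  What remains is to exclude that \<open>\<Delta>\<close> tends to \<open>0\<close>.  If \<open>\<epsilon> = 1\<close>, the first coordinate is
  \<open>x E^{-b} \<Delta>^{-m}\<close>, which can stay bounded only if \<open>x = 0\<close>; but then \<open>\<Delta> = 1\<close>, because \<open>a > 0\<close>
  and, by \<open>\<alpha>m = 1 + \<beta>n\<close>, also \<open>\<alpha> > 0\<close>.  If \<open>\<epsilon> = -1\<close>, the second coordinate plays this part.
\<close>

lemma \<Phi>_maximal:
  assumes dom: "\<And>i::nat. (\<gamma> i, (x, y)) \<in> \<Omega>" and lim: "\<gamma> \<longlonglongrightarrow> (s, t)"
    and img: "(\<lambda>i. \<Phi> (\<gamma> i, (x, y))) \<longlonglongrightarrow> (x', y')" and base: "x' ^ n * y' ^ m \<in> B"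
  shows "((s, t), (x, y)) \<in> \<Omega>"
proof -
  define z where "z = x ^ n * y ^ m"
  define e where "e i = E (snd (\<gamma> i), z)" for i
  define d where "d i = \<Delta> (\<gamma> i, (x, y))" for i
  define x1 where "x1 i = fst (\<Phi> (\<gamma> i, (x, y)))" for i
  define y1 where "y1 i = snd (\<Phi> (\<gamma> i, (x, y)))" for i
  have lims: "(\<lambda>i. fst (\<gamma> i)) \<longlonglongrightarrow> s" "(\<lambda>i. snd (\<gamma> i)) \<longlonglongrightarrow> t"
    using tendsto_fst[OF lim] tendsto_snd[OF lim] by simp_all
  have xy1: "x1 \<longlonglongrightarrow> x'" "y1 \<longlonglongrightarrow> y'"
    using tendsto_fst[OF img] tendsto_snd[OF img] by (simp_all add: x1_def[abs_def] y1_def[abs_def])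
  have dom': "((fst (\<gamma> i), snd (\<gamma> i)), (x, y)) \<in> \<Omega>" for i using dom by simp
  have Qi: "(snd (\<gamma> i), z) \<in> Q" and nz: "e i \<noteq> 0" "d i \<noteq> 0" for i
    using dom'[of i] domain by (auto simp: \<Omega>_def z_def e_def d_def)
  have "x1 i ^ n * y1 i ^ m = z * E (snd (\<gamma> i), z)" for i
    using \<Phi>_monomials(1)[OF dom'[of i], of "x1 i" "y1 i"] by (simp add: x1_def y1_def z_def)
  moreover have "(\<lambda>i. x1 i ^ n * y1 i ^ m) \<longlonglongrightarrow> x' ^ n * y' ^ m"
    by (intro tendsto_intros xy1)
  ultimately have "(\<lambda>i. z * E (snd (\<gamma> i), z)) \<longlonglongrightarrow> x' ^ n * y' ^ m" by simp
  moreover have "z \<in> B" using Qi[of 0] domain by blast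
  ultimately have Qt: "(t, z) \<in> Q"
    using maximal[of z "\<lambda>i. snd (\<gamma> i)"] Qi lims(2) base by blast
  have "isCont E (t, z)" "isCont \<kappa> (t, z)"
    using Qt holomorphic \<kappa>_holomorphic cdifferentiable_imp_isCont by blast+
  then have lim_e: "e \<longlonglongrightarrow> E (t, z)" and lim_\<kappa>: "(\<lambda>i. \<kappa> (snd (\<gamma> i), z)) \<longlonglongrightarrow> \<kappa> (t, z)"
    unfolding e_def by (auto intro!: isCont_tendsto_compose[where g = E] isCont_tendsto_compose[where g = \<kappa>] tendsto_intros lims)
  have d: "d i = 1 - of_int \<epsilon> * fst (\<gamma> i) * (x ^ a * y ^ b) - x ^ \<alpha> * y ^ \<beta> * \<kappa> (snd (\<gamma> i), z)" for i
    by (simp add: d_def \<Delta>_def z_def case_prod_beta)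
  have x1: "x1 i = x * e i powi (- \<epsilon> * int b) * d i powi (- \<epsilon> * int m)"
    and y1: "y1 i = y * e i powi (\<epsilon> * int a) * d i powi (\<epsilon> * int n)" for i
    by (simp_all add: x1_def y1_def \<Phi>_def e_def d_def z_def case_prod_unfold)
  have lim_d: "d \<longlonglongrightarrow> \<Delta> ((s, t), (x, y))"
    unfolding d \<Delta>_def prod.case z_def[symmetric] by (intro tendsto_intros lims lim_\<kappa>)
  have "\<Delta> ((s, t), (x, y)) \<noteq> 0"
  proof
    assume zero: "\<Delta> ((s, t), (x, y)) = 0"
    from unimodular(1) consider "\<epsilon> = 1" | "\<epsilon> = -1" by auto
    then show False
    proof cases
      case 1
      have "x1 i * e i ^ b * d i ^ m = x" for i
        using nz[of i] unfolding x1 1 by (simp add: power_int_minus field_simps)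
      moreover have "(\<lambda>i. x1 i * e i ^ b * d i ^ m) \<longlonglongrightarrow> x' * E (t, z) ^ b * \<Delta> ((s, t), (x, y)) ^ m"
        by (intro tendsto_intros xy1 lim_e lim_d)
      ultimately have "x = x' * E (t, z) ^ b * \<Delta> ((s, t), (x, y)) ^ m"
        by (simp add: LIMSEQ_const_iff)
      then have "x = 0" using zero pos by simp
      moreover have "\<alpha> > 0" using reduced_unimodular 1 by (cases \<alpha>) (auto simp flip: of_nat_mult)
      ultimately show False using zero pos by (simp add: \<Delta>_def zero_power)
    next
      case 2
      have "y1 i * e i ^ a * d i ^ n = y" for i
        using nz[of i] unfolding y1 2 by (simp add: power_int_minus field_simps)
      moreover have "(\<lambda>i. y1 i * e i ^ a * d i ^ n) \<longlonglongrightarrow> y' * E (t, z) ^ a * \<Delta> ((s, t), (x, y)) ^ n"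
        by (intro tendsto_intros xy1 lim_e lim_d)
      ultimately have "y = y' * E (t, z) ^ a * \<Delta> ((s, t), (x, y)) ^ n"
        by (simp add: LIMSEQ_const_iff)
      then have "y = 0" using zero pos by simp
      moreover have "\<beta> > 0" using reduced_unimodular 2 by (cases \<beta>) (auto simp flip: of_nat_mult)
      ultimately show False using zero pos by (simp add: \<Delta>_def zero_power)
    qed
  qed
  then show ?thesis using Qt by (simp add: \<Omega>_def z_def)
qed

text \<open>
  At time \<open>0\<close> both \<open>E\<close> and \<open>\<Delta>\<close> equal \<open>1\<close>, so the derivative of each power is its exponent times the
  derivative of the base; the two field components come out because \<open>\<epsilon>^2 = 1\<close>.
\<close>

lemma \<Phi>_generator:
  assumes z: "x ^ n * y ^ m \<in> B" and F: "F (x, y) = x ^ \<alpha> * y ^ \<beta> * f (x ^ n * y ^ m)"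
  shows "((\<lambda>h. \<Phi> (h, (x, y))) has_derivative
    (\<lambda>v. fst v *\<^sub>C field_X a b m n (x, y) + snd v *\<^sub>C field_Y a b m n g F (x, y))) (at 0)"
proof -
  define z where "z = x ^ n * y ^ m"
  define e d where "e = (\<lambda>h::complex \<times> complex. E (snd h, z))" and "d = (\<lambda>h. \<Delta> (h, (x, y)))"
  have zB: "z \<in> B" using z by (simp add: z_def)
  have e0: "e 0 = 1" and d0: "d 0 = 1"
    using start[OF zB] \<kappa>_start[OF zB] by (simp_all add: e_def d_def \<Delta>_def z_def zero_prod_def)
  define E' where "E' = of_int \<epsilon> * of_nat m * g z"
  define K' where "K' = of_int \<epsilon> * g z * f z / of_nat m"
  have snd0: "(snd has_derivative snd) (at (0 :: complex \<times> complex))"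
    and fst0: "(fst has_derivative fst) (at (0 :: complex \<times> complex))"
    by (auto intro!: derivative_eq_intros)
  have de: "(e has_derivative (\<lambda>v. E' * snd v)) (at 0)"
    unfolding e_def by (rule has_derivative_field_compose[OF snd0]) (use generator[OF zB] in \<open>simp add: E'_def\<close>)
  have dk: "((\<lambda>h :: complex \<times> complex. \<kappa> (snd h, z)) has_derivative (\<lambda>v. K' * snd v)) (at 0)"
    by (rule has_derivative_field_compose[OF snd0, where h = "\<lambda>t. \<kappa> (t, z)"]) (use \<kappa>_generator[OF zB] in \<open>simp add: K'_def\<close>)
  have d_eq: "d = (\<lambda>h. 1 - fst h * (of_int \<epsilon> * (x ^ a * y ^ b)) - \<kappa> (snd h, z) * (x ^ \<alpha> * y ^ \<beta>))"
    by (rule ext) (simp add: d_def \<Delta>_def z_def case_prod_unfold)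
  have dd: "(d has_derivative (\<lambda>v. 0 - fst v * (of_int \<epsilon> * (x ^ a * y ^ b)) - K' * snd v * (x ^ \<alpha> * y ^ \<beta>))) (at 0)"
    unfolding d_eq
    by (intro has_derivative_diff has_derivative_const has_derivative_mult_left fst0 dk)
  have powi: "((\<lambda>u. u powi p) has_field_derivative of_int p) (at (1::complex))" for p
    using DERIV_power_int[OF DERIV_ident, where x = "1::complex" and n = p and s = UNIV] by simp
  have de': "((\<lambda>h. e h powi p) has_derivative (\<lambda>v. of_int p * (E' * snd v))) (at 0)" for p
    by (rule has_derivative_field_compose[OF de, where h = "\<lambda>u. u powi p"]) (use powi e0 in simp)
  have dd': "((\<lambda>h. d h powi p) has_derivative (\<lambda>v. of_int p * (0 - fst v * (of_int \<epsilon> * (x ^ a * y ^ b)) - K' * snd v * (x ^ \<alpha> * y ^ \<beta>)))) (at 0)" for p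
    by (rule has_derivative_field_compose[OF dd, where h = "\<lambda>u. u powi p"]) (use powi d0 in simp)
  have prod: "((\<lambda>h. u * e h powi p * d h powi q) has_derivative
     (\<lambda>v. u * (of_int p * (E' * snd v)) + u * (of_int q * (0 - fst v * (of_int \<epsilon> * (x ^ a * y ^ b)) - K' * snd v * (x ^ \<alpha> * y ^ \<beta>))))) (at 0)" for u p q
    by (rule has_derivative_eq_rhs[OF has_derivative_mult[OF has_derivative_mult_right[OF de'] dd']])
      (simp add: e0 d0 add.commute)
  have m0: "of_nat m \<noteq> (0::complex)" using pos by simp
  have \<epsilon>2: "of_int \<epsilon> * (of_int \<epsilon> * u) = (u::complex)" for u
    using eps_square by (simp flip: mult.assoc of_int_mult)
  have "(\<lambda>h. \<Phi> (h, (x, y))) = (\<lambda>h. (x * e h powi (- \<epsilon> * int b) * d h powi (- \<epsilon> * int m),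
      y * e h powi (\<epsilon> * int a) * d h powi (\<epsilon> * int n)))"
    by (rule ext) (simp add: \<Phi>_def e_def d_def z_def case_prod_unfold)
  then show ?thesis
  proof (rule ssubst, intro has_derivative_eq_rhs[OF has_derivative_Pair[OF prod prod]] ext prod_eqI)
    fix v :: "complex \<times> complex"
    show "fst (x * (of_int (- \<epsilon> * int b) * (E' * snd v)) +
          x * (of_int (- \<epsilon> * int m) * (0 - fst v * (of_int \<epsilon> * (x ^ a * y ^ b)) - K' * snd v * (x ^ \<alpha> * y ^ \<beta>))),
         y * (of_int (\<epsilon> * int a) * (E' * snd v)) +
          y * (of_int (\<epsilon> * int n) * (0 - fst v * (of_int \<epsilon> * (x ^ a * y ^ b)) - K' * snd v * (x ^ \<alpha> * y ^ \<beta>))))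
      = fst (fst v *\<^sub>C field_X a b m n (x, y) + snd v *\<^sub>C field_Y a b m n g F (x, y))"
      using m0 by (simp add: E'_def K'_def field_X_def field_Y_def F z_def[symmetric] scaleC_prod_def
          scaleC_complex_def \<epsilon>2 field_simps)
    show "snd (x * (of_int (- \<epsilon> * int b) * (E' * snd v)) +
          x * (of_int (- \<epsilon> * int m) * (0 - fst v * (of_int \<epsilon> * (x ^ a * y ^ b)) - K' * snd v * (x ^ \<alpha> * y ^ \<beta>))),
         y * (of_int (\<epsilon> * int a) * (E' * snd v)) +
          y * (of_int (\<epsilon> * int n) * (0 - fst v * (of_int \<epsilon> * (x ^ a * y ^ b)) - K' * snd v * (x ^ \<alpha> * y ^ \<beta>))))
      = snd (fst v *\<^sub>C field_X a b m n (x, y) + snd v *\<^sub>C field_Y a b m n g F (x, y))"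
      using m0 by (simp add: E'_def K'_def field_X_def field_Y_def F z_def[symmetric] scaleC_prod_def
          scaleC_complex_def \<epsilon>2 field_simps)
  qed
qed

text \<open>
  Eliminating \<open>s\<close> by the combination \<open>n\<close> times the first plus \<open>m\<close> times the second logarithmic component
  leaves \<open>t m \<epsilon> g(z) = 0\<close>: this is the action of the field on \<open>z\<close>, where \<open>X\<close> vanishes.
\<close>

lemma fields_independent:
  assumes z: "x ^ n * y ^ m \<in> B" and xy: "x \<noteq> 0" "y \<noteq> 0"
    and zero: "s *\<^sub>C field_X a b m n (x, y) + t *\<^sub>C field_Y a b m n g F (x, y) = 0"
  shows "s = 0 \<and> t = 0"
proof -
  define w G H where "w = x ^ a * y ^ b" and "G = g (x ^ n * y ^ m)" and "H = F (x, y)"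
  have m0: "of_nat m \<noteq> (0::complex)" using pos by simp
  have "x * (s * (of_nat m * w) + t * (G * (- of_nat (b * m) + H))) = 0"
    "y * (s * (- of_nat n * w) + t * (G * (of_nat (a * m) - of_nat n / of_nat m * H))) = 0"
    using zero by (simp_all add: field_X_def field_Y_def scaleC_prod_def scaleC_complex_def zero_prod_def
        w_def G_def H_def algebra_simps)
  then have 1: "s * (of_nat m * w) + t * (G * (- of_nat (b * m) + H)) = 0"
    and 2: "s * (- of_nat n * w) + t * (G * (of_nat (a * m) - of_nat n / of_nat m * H)) = 0"
    using xy by auto
  have "of_nat n * (s * (of_nat m * w) + t * (G * (- of_nat (b * m) + H))) +
      of_nat m * (s * (- of_nat n * w) + t * (G * (of_nat (a * m) - of_nat n / of_nat m * H)))
    = t * G * of_nat m * of_int (int a * int m - int b * int n)"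
    using m0 by (simp add: field_simps)
  then have "t * G * of_nat m * of_int (int a * int m - int b * int n) = 0"
    by (simp only: 1 2 mult_zero_right add_0)
  moreover have "G \<noteq> 0" using g_nonzero[OF z] xy by (simp add: G_def)
  ultimately have "t = 0" using unimodular m0 by auto
  then show ?thesis using 1 m0 xy by (simp add: w_def)
qed

text \<open>
  The fundamental fields of the action are the constant combinations of \<open>X\<close> and \<open>Y\<close>, which exhaust
  the Lie algebra because the two commute.  Distinct combinations differ at a point \<open>(h, h)\<close> with a
  small \<open>h \<noteq> 0\<close>.
\<close>

theorem univalent:
  assumes U: "open U" "connected U" "(0, 0) \<in> U"
    and base: "\<And>x y. (x, y) \<in> U \<Longrightarrow> x ^ n * y ^ m \<in> B"
    and F: "\<And>x y. (x, y) \<in> U \<Longrightarrow> F (x, y) = x ^ \<alpha> * y ^ \<beta> * f (x ^ n * y ^ m)"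
  shows "univalent_C2_on (generated_lie_algebra U {field_X a b m n, field_Y a b m n g F}) U"
proof -
  have "maximal_local_action U
     {(g, p). p \<in> U \<and> connected_component {g. (g, p) \<in> \<Omega> \<and> \<Phi> (g, p) \<in> U} 0 g} \<Phi>"
  proof (rule maximal_local_action_restrict[OF \<Phi>_holomorphic U(1,2)])
    show "(0, p) \<in> \<Omega> \<and> \<Phi> (0, p) = p" if "p \<in> U" for p
      using that base \<Phi>_start by (cases p) (auto simp: zero_prod_def)
    show "(\<gamma>, p) \<in> \<Omega>" if "\<And>i. (s i, p) \<in> \<Omega>" "s \<longlonglongrightarrow> \<gamma>" "(\<lambda>i. \<Phi> (s i, p)) \<longlonglongrightarrow> q" "q \<in> U" for p s \<gamma> q
      using that base \<Phi>_maximal by (cases p; cases \<gamma>; cases q) blast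
  qed (rule \<Phi>_action)
  moreover have "bij_betw (fundamental_field U \<Phi>) UNIV
     (generated_lie_algebra U {field_X a b m n, field_Y a b m n g F})"
  proof -
    define V where "V v = restrict_field U (\<lambda>p. fst v *\<^sub>C field_X a b m n p + snd v *\<^sub>C field_Y a b m n g F p)"
      for v :: "complex \<times> complex"
    have fund: "fundamental_field U \<Phi> = V"
    proof (intro ext)
      fix v p
      show "fundamental_field U \<Phi> v p = V v p"
      proof (cases "p \<in> U")
        case True
        moreover obtain x y where p: "p = (x, y)" by fastforce
        ultimately have "(x, y) \<in> U" by simp
        from frechet_derivative_at[OF \<Phi>_generator[of x y F, OF base[OF this] F[OF this]]] True
        show ?thesis
          by (simp add: fundamental_field_def V_def restrict_field_def p fun_eq_iff)
      qed (simp add: fundamental_field_def V_def restrict_field_def)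
    qed
    have "generated_lie_algebra U {field_X a b m n, field_Y a b m n g F} = range V"
      unfolding V_def[abs_def]
    proof (rule generated_lie_algebra_commuting[OF U(1)])
      fix p assume p: "p \<in> U"
      obtain x y where xy: "p = (x, y)" by fastforce
      have z: "x ^ n * y ^ m \<in> B" using p base by (simp add: xy)
      have diff: "f field_differentiable (at (x ^ n * y ^ m))" "g field_differentiable (at (x ^ n * y ^ m))"
        using z f_holo g_holo open_base holomorphic_on_imp_differentiable_at by blast+
      have \<epsilon>: "of_nat (a * m) - of_nat (b * n) = (of_int \<epsilon> :: complex)"
        "of_nat (\<alpha> * m) - of_nat (\<beta> * n) = (of_int \<epsilon> :: complex)"
        unfolding unimodular(2)[symmetric] by simp (simp add: reduced_unimodular[symmetric] unimodular(2))
      note * = fields_commute[where F = F and f = f and \<alpha> = \<alpha> and \<beta> = \<beta> and n = n and m = m and U = U,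
          OF F U(1) p[unfolded xy] pos(3) \<epsilon> diff]
      show "field_X a b m n cdifferentiable_at p" "field_Y a b m n g F cdifferentiable_at p"
        "lie_bracket (field_X a b m n) (field_Y a b m n g F) p = 0"
        unfolding xy by (rule *; assumption)+
    qed
    moreover have "inj V"
    proof (rule injI)
      fix v v' assume eq: "V v = V v'"
      obtain r where r: "r > 0" "ball (0, 0) r \<subseteq> U"
        using U(1,3) open_contains_ball by blast
      define h where "h = complex_of_real (r / 2)"
      have h: "h \<noteq> 0" "(h, h) \<in> U"
      proof -
        have "norm (h, h) < r"
          using r(1) by (simp add: h_def norm_prod_def real_sqrt_mult norm_of_real)
            (smt (verit) sqrt2_less_2)
        then have "(h, h) \<in> ball (0, 0) r" by (simp add: mem_ball dist_norm norm_prod_def)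
        then show "(h, h) \<in> U" using r(2) by blast
      qed (use r(1) in \<open>simp add: h_def\<close>)
      have "V v (h, h) = V v' (h, h)" using eq by simp
      then have "(fst v - fst v') *\<^sub>C field_X a b m n (h, h) + (snd v - snd v') *\<^sub>C field_Y a b m n g F (h, h) = 0"
        using h(2) by (simp add: V_def restrict_field_def scaleC_prod_def scaleC_complex_def algebra_simps zero_prod_def prod_eq_iff)
      from fields_independent[OF base[OF h(2)] h(1) h(1) this]
      show "v = v'" by (simp add: prod_eq_iff)
    qed
    ultimately show ?thesis by (simp add: fund bij_betw_def)
  qed
  ultimately show ?thesis unfolding univalent_C2_on_def by blast
qed

end

section \<open>Model flows and their conjugates\<close>

lemma scaling_flow_exp:
  assumes "r > 0"
  shows "scaling_flow (ball 0 r) {(t, z). z \<in> ball 0 r \<and> z * exp (l * t) \<in> ball 0 r}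
    (\<lambda>(t, z). exp (l * t)) (\<lambda>_. l)"
proof
  show "open {(t, z). z \<in> ball 0 r \<and> z * exp (l * t) \<in> ball 0 r}"
  proof -
    have "open ((\<lambda>q. snd q) -` ball 0 r \<inter> (\<lambda>q. snd q * exp (l * fst q)) -` ball 0 r)"
      by (intro open_Int open_vimage open_ball continuous_intros)
    also have "\<dots> = {(t, z). z \<in> ball 0 r \<and> z * exp (l * t) \<in> ball 0 r}" by auto
    finally show ?thesis .
  qed
  show "(\<lambda>(t, z). exp (l * t)) cdifferentiable_at q" for q :: "complex \<times> complex"
    unfolding case_prod_beta
    by (rule cdifferentiable_field_compose[of _ _ "\<lambda>t. exp (l * t)", OF cdifferentiable_fst[OF cdifferentiable_ident]])
      (auto simp: field_differentiable_def intro!: exI derivative_eq_intros)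
next
  fix z t z' :: complex and \<tau>
  assume z: "z \<in> ball 0 r" "\<tau> \<longlonglongrightarrow> t" "z' \<in> ball 0 r"
    and lim: "(\<lambda>i::nat. z * (case (\<tau> i, z) of (t, z) \<Rightarrow> exp (l * t))) \<longlonglongrightarrow> z'"
  have "(\<lambda>i. z * exp (l * \<tau> i)) \<longlonglongrightarrow> z * exp (l * t)" by (intro tendsto_intros z)
  then have "z' = z * exp (l * t)" using lim LIMSEQ_unique by simp blast
  then show "(t, z) \<in> {(t, z). z \<in> ball 0 r \<and> z * exp (l * t) \<in> ball 0 r}" using z by auto
next
  fix z :: complex
  show "((\<lambda>t. case (t, z) of (t, z) \<Rightarrow> exp (l * t)) has_field_derivative l) (at 0)"
    by (auto intro!: derivative_eq_intros)
qed (use assms in \<open>auto simp: exp_add distrib_left mult_ac\<close>)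

lemma scaling_flow_quadratic:
  assumes "r > 0"
  shows "scaling_flow (ball 0 r) {(t, z). z \<in> ball 0 r \<and> t * z \<noteq> 1 \<and> z / (1 - t * z) \<in> ball 0 r}
    (\<lambda>(t, z). 1 / (1 - t * z)) (\<lambda>z. z)"
proof
  show "open {(t :: complex, z). z \<in> ball 0 r \<and> t * z \<noteq> 1 \<and> z / (1 - t * z) \<in> ball 0 r}"
  proof -
    let ?S = "(\<lambda>q::complex \<times> complex. snd q) -` ball 0 r \<inter> (\<lambda>q. fst q * snd q) -` (- {1})"
    have S: "open ?S"
      by (intro open_Int open_vimage open_ball continuous_intros)
    have "open (?S \<inter> (\<lambda>q. snd q / (1 - fst q * snd q)) -` ball 0 r)"
      by (intro continuous_open_preimage S open_ball continuous_intros) auto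
    also have "\<dots> = {(t, z). z \<in> ball 0 r \<and> t * z \<noteq> 1 \<and> z / (1 - t * z) \<in> ball 0 r}" by auto
    finally show ?thesis .
  qed
  show "(\<lambda>(t :: complex, z). 1 / (1 - t * z)) cdifferentiable_at q"
    if "q \<in> {(t, z). z \<in> ball 0 r \<and> t * z \<noteq> 1 \<and> z / (1 - t * z) \<in> ball 0 r}" for q
    unfolding case_prod_beta using that by (intro cdifferentiable_intros) auto
next
  fix z t z' :: complex and \<tau>
  assume z: "z \<in> ball 0 r" "\<tau> \<longlonglongrightarrow> t" "z' \<in> ball 0 r"
    and dom: "\<And>i. (\<tau> i, z) \<in> {(t, z). z \<in> ball 0 r \<and> t * z \<noteq> 1 \<and> z / (1 - t * z) \<in> ball 0 r}"
    and lim: "(\<lambda>i::nat. z * (case (\<tau> i, z) of (t, z) \<Rightarrow> 1 / (1 - t * z))) \<longlonglongrightarrow> z'"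
  \<comment> \<open>Multiplying by \<open>1 - t z\<close> first shows that this factor does not vanish in the limit.\<close>
  have "(\<lambda>i. z / (1 - \<tau> i * z) * (1 - \<tau> i * z)) \<longlonglongrightarrow> z' * (1 - t * z)"
    using lim by (intro tendsto_intros z) simp
  moreover have "z / (1 - \<tau> i * z) * (1 - \<tau> i * z) = z" for i using dom[of i] by auto
  ultimately have eq: "z' * (1 - t * z) = z" by (simp add: LIMSEQ_const_iff)
  then have "t * z \<noteq> 1" by auto
  moreover from this have "z / (1 - t * z) = z'" using eq by (auto simp: field_simps)
  ultimately show "(t, z) \<in> {(t, z). z \<in> ball 0 r \<and> t * z \<noteq> 1 \<and> z / (1 - t * z) \<in> ball 0 r}"
    using z by auto
next
  fix z :: complex
  show "((\<lambda>t. case (t, z) of (t, z) \<Rightarrow> 1 / (1 - t * z)) has_field_derivative z) (at 0)"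
    by (auto intro!: derivative_eq_intros)
next
  fix t t' z :: complex
  assume "(t, z) \<in> {(t, z). z \<in> ball 0 r \<and> t * z \<noteq> 1 \<and> z / (1 - t * z) \<in> ball 0 r}"
    "(t' + t, z) \<in> {(t, z). z \<in> ball 0 r \<and> t * z \<noteq> 1 \<and> z / (1 - t * z) \<in> ball 0 r}"
  then have "1 - t * z \<noteq> 0" "1 - (t' + t) * z \<noteq> 0" by auto
  moreover have "1 - t' * (z * (1 / (1 - t * z))) = (1 - (t' + t) * z) / (1 - t * z)"
    using \<open>1 - t * z \<noteq> 0\<close> by (simp add: field_simps)
  ultimately show "(case (t' + t, z) of (t, z) \<Rightarrow> 1 / (1 - t * z)) =
      (case (t, z) of (t, z) \<Rightarrow> 1 / (1 - t * z)) *
      (case (t', z * (case (t, z) of (t, z) \<Rightarrow> 1 / (1 - t * z))) of (t, z) \<Rightarrow> 1 / (1 - t * z))"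
    by simp
qed (use assms in \<open>auto\<close>)

text \<open>
  The coordinate \<open>\<psi>(z) = z P(z)\<close> is locally invertible, since \<open>P(0) \<noteq> 0\<close>, and the differential
  equation in the hypothesis says that it carries the field \<open>z u(z) \<partial>/\<partial>z\<close> to \<open>\<zeta> v(\<zeta>) \<partial>/\<partial>\<zeta>\<close>.  Pulling
  the model flow back moves \<open>z\<close> to \<open>z1 = \<psi>^{-1}(\<psi>(z) e)\<close>; from \<open>z1 P(z1) = z P(z) e\<close> the new
  factor is read off as \<open>e P(z)/P(z1)\<close>, an expression that makes sense at \<open>z = 0\<close> as well.  The
  model is required on discs of every radius because the radius is only found during the inversion.
\<close>

lemma scaling_flow_conjugate:
  assumes \<rho>: "\<rho> > 0" and P: "P holomorphic_on ball 0 \<rho>" "\<And>z. z \<in> ball 0 \<rho> \<Longrightarrow> P z \<noteq> 0"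
    and flow: "\<And>r. r > 0 \<Longrightarrow> scaling_flow (ball 0 r) (Q r) e v"
    and eq: "\<And>z. z \<in> ball 0 \<rho> \<Longrightarrow> (P z + z * deriv P z) * u z = P z * v (z * P z)"
  obtains B Q' E where "B \<subseteq> ball 0 \<rho>" "scaling_flow B Q' E u"
proof -
  define \<psi> where "\<psi> z = z * P z" for z
  have d\<psi>: "(\<psi> has_field_derivative P z + z * deriv P z) (at z)" if "z \<in> ball 0 \<rho>" for z
    unfolding \<psi>_def
    by (rule derivative_eq_intros holomorphic_derivI[OF P(1) open_ball that] | simp)+
  then have \<psi>_holo: "\<psi> holomorphic_on ball 0 \<rho>"
    using holomorphic_on_open open_ball by blast
  have d\<psi>0: "deriv \<psi> 0 \<noteq> 0"
    using DERIV_imp_deriv[OF d\<psi>[of 0]] P(2)[of 0] \<rho> by simp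
  have z\<rho>: "(0 :: complex) \<in> ball 0 \<rho>" using \<rho> by simp
  obtain \<sigma> where \<sigma>: "\<sigma> > 0" "ball (0 :: complex) \<sigma> \<subseteq> ball 0 \<rho>" "inj_on \<psi> (ball 0 \<sigma>)"
    by (rule has_complex_derivative_locally_injective[OF \<psi>_holo z\<rho> open_ball d\<psi>0]) (rule that)
  have \<psi>_holo': "\<psi> holomorphic_on ball 0 \<sigma>" using \<psi>_holo \<sigma>(2) holomorphic_on_subset by blast
  obtain G where G: "G holomorphic_on (\<psi> ` ball 0 \<sigma>)"
    "\<And>z. z \<in> ball 0 \<sigma> \<Longrightarrow> deriv \<psi> z * deriv G (\<psi> z) = 1"
    "\<And>z. z \<in> ball 0 \<sigma> \<Longrightarrow> G (\<psi> z) = z"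
    using holomorphic_has_inverse[OF \<psi>_holo' open_ball \<sigma>(3)] by blast
  have op: "open (\<psi> ` ball 0 \<sigma>)" by (rule open_mapping_thm3[OF \<psi>_holo' open_ball \<sigma>(3)])
  moreover have "0 \<in> \<psi> ` ball 0 \<sigma>" using \<sigma>(1) by (force simp: \<psi>_def)
  ultimately obtain r where r: "r > 0" "ball 0 r \<subseteq> \<psi> ` ball 0 \<sigma>"
    using open_contains_ball by blast
  interpret S: scaling_flow "ball 0 r" "Q r" e v by (rule flow[OF r(1)])
  define B where "B = ball 0 \<sigma> \<inter> \<psi> -` ball 0 r"
  define Q' where "Q' = {(t, z). z \<in> B \<and> (t, \<psi> z) \<in> Q r}"
  define z1 where "z1 t z = G (\<psi> z * e (t, \<psi> z))" for t z
  define E where "E = (\<lambda>(t, z). e (t, \<psi> z) * P z / P (z1 t z))"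
  have GB: "G w \<in> B \<and> \<psi> (G w) = w" if "w \<in> ball 0 r" for w
    using that r(2) G(3) by (auto simp: B_def)
  have B\<rho>: "B \<subseteq> ball 0 \<rho>" using \<sigma>(2) by (auto simp: B_def)
  have B\<psi>: "\<psi> z \<in> ball 0 r" "G (\<psi> z) = z" if "z \<in> B" for z
    using that G(3) by (auto simp: B_def)
  have P0: "P z \<noteq> 0" if "z \<in> B" for z using that P(2) B\<rho> by auto
  have openB: "open B" unfolding B_def
    by (rule continuous_open_preimage[OF holomorphic_on_imp_continuous_on[OF \<psi>_holo'] open_ball open_ball])
  have z1: "z1 t z \<in> B" "\<psi> (z1 t z) = \<psi> z * e (t, \<psi> z)" "e (t, \<psi> z) \<noteq> 0" "z * E (t, z) = z1 t z"
    "E (t, z) \<noteq> 0" if "(t, z) \<in> Q'" for t z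
  proof -
    have q: "(t, \<psi> z) \<in> Q r" "z \<in> B" using that by (auto simp: Q'_def)
    show 1: "z1 t z \<in> B" and 2: "\<psi> (z1 t z) = \<psi> z * e (t, \<psi> z)" and 3: "e (t, \<psi> z) \<noteq> 0"
      using S.domain[OF q(1)] GB by (auto simp: z1_def)
    show "z * E (t, z) = z1 t z"
      using 2 P0[OF 1] by (simp add: E_def \<psi>_def field_simps)
    show "E (t, z) \<noteq> 0" using 3 P0[OF 1] P0[OF q(2)] by (simp add: E_def)
  qed
  have dG: "(G has_field_derivative 1 / (P z + z * deriv P z)) (at (\<psi> z))"
    and d0: "P z + z * deriv P z \<noteq> 0" if "z \<in> B" for z
  proof -
    have z: "z \<in> ball 0 \<sigma>" "z \<in> ball 0 \<rho>" using that B\<rho> by (auto simp: B_def)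
    have 1: "(P z + z * deriv P z) * deriv G (\<psi> z) = 1"
      using G(2)[OF z(1)] DERIV_imp_deriv[OF d\<psi>[OF z(2)]] by simp
    then show d0: "P z + z * deriv P z \<noteq> 0" by auto
    have "deriv G (\<psi> z) = 1 / (P z + z * deriv P z)"
      using 1 d0 by (simp add: eq_divide_eq mult.commute)
    moreover have "(G has_field_derivative deriv G (\<psi> z)) (at (\<psi> z))"
      by (rule holomorphic_derivI[OF G(1) op]) (use z in auto)
    ultimately show "(G has_field_derivative 1 / (P z + z * deriv P z)) (at (\<psi> z))"
      by simp
  qed
  have "scaling_flow B Q' E u"
  proof
    show "open B" by (fact openB)
    show "0 \<in> B" using \<sigma>(1) r(1) by (simp add: B_def \<psi>_def)
    show "open Q'"
    proof -
      have "open (UNIV \<times> B \<inter> (\<lambda>q. (fst q, \<psi> (snd q))) -` Q r)"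
      proof (rule continuous_open_preimage[OF _ _ S.open_domain])
        show "open ((UNIV :: complex set) \<times> B)" by (intro open_Times openB open_UNIV)
        have "continuous_on B \<psi>"
          using holomorphic_on_imp_continuous_on[OF \<psi>_holo] B\<rho> continuous_on_subset by blast
        then show "continuous_on (UNIV \<times> B) (\<lambda>q :: complex \<times> complex. (fst q, \<psi> (snd q)))"
          by (intro continuous_intros continuous_on_compose2[of B \<psi> _ snd]) auto
      qed
      also have "UNIV \<times> B \<inter> (\<lambda>q. (fst q, \<psi> (snd q))) -` Q r = Q'" by (auto simp: Q'_def)
      finally show ?thesis .
    qed
  next
    fix t z assume "(t, z) \<in> Q'"
    then show "z \<in> B \<and> E (t, z) \<noteq> 0 \<and> z * E (t, z) \<in> B" using z1[of t z] by (auto simp: Q'_def)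
  next
    fix z assume z: "z \<in> B"
    have z1_start: "z1 0 z = z" using S.start[OF B\<psi>(1)[OF z]] B\<psi>(2)[OF z] by (simp add: z1_def)
    then show "(0, z) \<in> Q' \<and> E (0, z) = 1"
      using z S.start[OF B\<psi>(1)[OF z]] P0[OF z] by (simp add: Q'_def E_def)
    define D where "D = P z + z * deriv P z"
    note D0 = d0[OF z, folded D_def]
    have e: "((\<lambda>t. e (t, \<psi> z)) has_field_derivative v (\<psi> z)) (at 0)"
      using S.generator[OF B\<psi>(1)[OF z]] .
    have e0: "e (0, \<psi> z) = 1" using S.start[OF B\<psi>(1)[OF z]] by simp
    have "z \<in> ball 0 \<rho>" using z B\<rho> by blast
    note eqz = eq[OF this, folded \<psi>_def]
    have "\<psi> z * v (\<psi> z) = z * (P z * v (\<psi> z))" by (simp add: \<psi>_def)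
    also have "\<dots> = D * (z * u z)" unfolding eqz[symmetric] D_def by simp
    finally have zu: "\<psi> z * v (\<psi> z) / D = z * u z" using D0 by simp
    have "((\<lambda>t. z1 t z) has_field_derivative 1 / D * (\<psi> z * v (\<psi> z))) (at 0)"
      unfolding z1_def
      by (rule DERIV_chain2[where f = G, OF _ DERIV_cmult[OF e]]) (use dG[OF z] e0 in \<open>simp add: D_def\<close>)
    then have dz1: "((\<lambda>t. z1 t z) has_field_derivative z * u z) (at 0)"
      using zu by simp
    have "(P has_field_derivative deriv P z) (at (z1 0 z))"
      unfolding z1_start using z B\<rho> by (intro holomorphic_derivI[OF P(1) open_ball]) auto
    from DERIV_chain2[OF this dz1]
    have dP: "((\<lambda>t. P (z1 t z)) has_field_derivative deriv P z * (z * u z)) (at 0)" .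
    have "((\<lambda>t. E (t, z)) has_field_derivative
       (v (\<psi> z) * P z * P (z1 0 z) - e (0, \<psi> z) * P z * (deriv P z * (z * u z))) / (P (z1 0 z) * P (z1 0 z))) (at 0)"
      unfolding E_def prod.case
      by (rule DERIV_divide[OF DERIV_cmult_right[OF e] dP]) (simp add: z1_start P0[OF z])
    also have "(v (\<psi> z) * P z * P (z1 0 z) - e (0, \<psi> z) * P z * (deriv P z * (z * u z))) / (P (z1 0 z) * P (z1 0 z))
        = (P z * v (\<psi> z) - z * deriv P z * u z) / P z"
      using P0[OF z] by (simp add: z1_start e0 field_simps)
    also have "\<dots> = u z"
      unfolding eqz[symmetric] using P0[OF z] by (simp add: field_simps)
    finally show "((\<lambda>t. E (t, z)) has_field_derivative u z) (at 0)" .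
  next
    fix t t' z assume Q: "(t, z) \<in> Q'" "(t', z * E (t, z)) \<in> Q'" "(t' + t, z) \<in> Q'"
    note z1t = z1[OF Q(1)]
    have Q2: "(t', z1 t z) \<in> Q'" using Q(2) z1t by simp
    have c: "e (t' + t, \<psi> z) = e (t, \<psi> z) * e (t', \<psi> z * e (t, \<psi> z))"
      using S.cocycle Q Q2 z1t(2) by (auto simp: Q'_def)
    have "z1 (t' + t) z = z1 t' (z1 t z)"
      by (simp add: z1_def[of "t' + t"] z1_def[of t' "z1 t z"] c z1t(2) mult.assoc)
    then show "E (t' + t, z) = E (t, z) * E (t', z * E (t, z))"
      unfolding z1t(4) using P0[OF z1t(1)] by (simp add: E_def c z1t(2))
  next
    fix q assume "q \<in> Q'"
    then obtain t z where q: "q = (t, z)" "z \<in> B" "(t, \<psi> z) \<in> Q r" "(t, z) \<in> Q'" by (auto simp: Q'_def)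
    note z1t = z1[OF q(4)]
    have fd: "\<psi> field_differentiable at (snd q)" "P field_differentiable at (snd q)"
      using q B\<rho> holomorphic_on_imp_differentiable_at[OF P(1) open_ball]
        holomorphic_on_imp_differentiable_at[OF \<psi>_holo open_ball] by auto
    have \<psi>: "(\<lambda>q. \<psi> (snd q)) cdifferentiable_at q"
      by (intro cdifferentiable_field_compose[where h = \<psi>] cdifferentiable_intros fd)
    have e: "(\<lambda>q. e (fst q, \<psi> (snd q))) cdifferentiable_at q"
      by (intro cdifferentiable_compose[where G = e and F = "\<lambda>q. (fst q, \<psi> (snd q))"]
          cdifferentiable_intros \<psi> S.holomorphic) (simp add: q)
    have "G field_differentiable at (\<psi> (snd q) * e (fst q, \<psi> (snd q)))"
      using dG[OF z1t(1)] z1t(2) by (auto simp: q(1) field_differentiable_def)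
    then have z: "(\<lambda>q. z1 (fst q) (snd q)) cdifferentiable_at q"
      unfolding z1_def by (intro cdifferentiable_field_compose[where h = G] cdifferentiable_intros \<psi> e)
    have "P field_differentiable at (z1 (fst q) (snd q))"
      using z1t(1) B\<rho> by (intro holomorphic_on_imp_differentiable_at[OF P(1) open_ball]) (auto simp: q)
    then have dP1: "(\<lambda>q. P (z1 (fst q) (snd q))) cdifferentiable_at q"
      by (intro cdifferentiable_field_compose[where h = P] z)
    have dP: "(\<lambda>q. P (snd q)) cdifferentiable_at q"
      by (intro cdifferentiable_field_compose[where h = P] cdifferentiable_intros fd)
    have "(\<lambda>q. e (fst q, \<psi> (snd q)) * P (snd q) / P (z1 (fst q) (snd q))) cdifferentiable_at q"
      using P0[OF z1t(1)]
      by (intro cdifferentiable_divide cdifferentiable_mult e dP dP1) (simp add: q)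
    then show "E cdifferentiable_at q" by (simp add: E_def case_prod_unfold)
  next
    fix z t z' :: complex and \<tau>
    assume z: "z \<in> B" "\<And>i::nat. (\<tau> i, z) \<in> Q'" "\<tau> \<longlonglongrightarrow> t" "z' \<in> B"
      and lim: "(\<lambda>i. z * E (\<tau> i, z)) \<longlonglongrightarrow> z'"
    have "isCont \<psi> z'" using d\<psi> z(4) B\<rho> DERIV_isCont by blast
    then have "(\<lambda>i. \<psi> (z * E (\<tau> i, z))) \<longlonglongrightarrow> \<psi> z'" using lim isCont_tendsto_compose by blast
    then have "(\<lambda>i. \<psi> z * e (\<tau> i, \<psi> z)) \<longlonglongrightarrow> \<psi> z'" using z1[OF z(2)] by simp
    then have "(t, \<psi> z) \<in> Q r"
      using S.maximal[OF B\<psi>(1)[OF z(1)] _ z(3) _ B\<psi>(1)[OF z(4)]] z(2) by (auto simp: Q'_def)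
    then show "(t, z) \<in> Q'" using z(1) by (simp add: Q'_def)
  qed
  then show thesis using that B\<rho> by blast
qed

section \<open>Primitives for the Euler operator\<close>

lemma holomorphic_split_value:
  assumes "f holomorphic_on ball 0 \<rho>" "\<rho> > 0"
  obtains q where "q holomorphic_on ball 0 \<rho>" "\<And>z. z \<in> ball 0 \<rho> \<Longrightarrow> f z = f 0 + z * q z"
proof
  define g where "g z = f z - f 0" for z
  define q where "q z = (if z = 0 then deriv g 0 else g z / z)" for z
  have "g holomorphic_on ball 0 \<rho>" unfolding g_def by (intro holomorphic_intros assms)
  then show "q holomorphic_on ball 0 \<rho>"
    by (rule pole_theorem_open_0[where a = 0]) (auto simp: q_def g_def)
  show "f z = f 0 + z * q z" if "z \<in> ball 0 \<rho>" for z
    by (simp add: q_def g_def)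
qed

text \<open>
  The operator \<open>z d/dz - k\<close> multiplies \<open>z^j\<close> by \<open>j - k\<close>, so it reaches every power series without a term
  of degree \<open>k\<close>; the constant \<open>c\<close> removes that term from \<open>f\<close>.  The induction on \<open>k\<close> splits off the value at
  \<open>0\<close> and divides by \<open>z\<close>, which lowers all degrees by one.  Dividing by \<open>z^k\<close> turns the equation into
  an integration of \<open>f(z)/z^{k+1}\<close> up to its residue.
\<close>

lemma euler_primitive:
  assumes "f holomorphic_on ball 0 \<rho>" "\<rho> > 0"
  obtains A c where "A holomorphic_on ball 0 \<rho>"
    "\<And>z. z \<in> ball 0 \<rho> \<Longrightarrow> z * deriv A z - of_nat k * A z = f z - c * z ^ k"
proof -
  have "\<exists>A c. A holomorphic_on ball 0 \<rho> \<and>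
    (\<forall>z\<in>ball 0 \<rho>. z * deriv A z - of_nat k * A z = f z - c * z ^ k)"
    using assms(1)
  proof (induction k arbitrary: f)
    case 0
    obtain q where q: "q holomorphic_on ball 0 \<rho>" "\<And>z. z \<in> ball 0 \<rho> \<Longrightarrow> f z = f 0 + z * q z"
      using holomorphic_split_value[OF 0 assms(2)] by blast
    obtain A where A: "\<And>z. z \<in> ball 0 \<rho> \<Longrightarrow> (A has_field_derivative q z) (at z within ball 0 \<rho>)"
      using holomorphic_convex_primitive'[OF convex_ball open_ball q(1)] by blast
    then have A': "(A has_field_derivative q z) (at z)" if "z \<in> ball 0 \<rho>" for z
      using that at_within_open[OF that open_ball] by metis
    have "A holomorphic_on ball 0 \<rho>" using A' holomorphic_on_open open_ball by blast
    moreover have "z * deriv A z - of_nat 0 * A z = f z - f 0 * z ^ 0" if "z \<in> ball 0 \<rho>" for z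
      using q(2)[OF that] DERIV_imp_deriv[OF A'[OF that]] by simp
    ultimately show ?case by blast
  next
    case (Suc k)
    obtain q where q: "q holomorphic_on ball 0 \<rho>" "\<And>z. z \<in> ball 0 \<rho> \<Longrightarrow> f z = f 0 + z * q z"
      using holomorphic_split_value[OF Suc.prems assms(2)] by blast
    from Suc.IH[OF q(1)] obtain A c where A: "A holomorphic_on ball 0 \<rho>"
      "\<And>z. z \<in> ball 0 \<rho> \<Longrightarrow> z * deriv A z - of_nat k * A z = q z - c * z ^ k" by blast
    define A' where "A' z = z * A z - f 0 / of_nat (Suc k)" for z
    have "A' holomorphic_on ball 0 \<rho>" unfolding A'_def by (intro holomorphic_intros A)
    moreover have "z * deriv A' z - of_nat (Suc k) * A' z = f z - c * z ^ Suc k"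
      if z: "z \<in> ball 0 \<rho>" for z
    proof -
      have "(A' has_field_derivative 1 * A z + deriv A z * z - 0) (at z)"
        unfolding A'_def
        by (intro DERIV_diff DERIV_mult DERIV_const DERIV_ident holomorphic_derivI[OF A(1) open_ball z])
      then have "deriv A' z = A z + z * deriv A z" using DERIV_imp_deriv by fastforce
      moreover have "of_nat (Suc k) * A' z = of_nat (Suc k) * z * A z - f 0"
        unfolding A'_def by (simp add: field_simps del: of_nat_Suc)
      ultimately have "z * deriv A' z - of_nat (Suc k) * A' z = f 0 + z * (z * deriv A z - of_nat k * A z)"
        by (simp add: algebra_simps)
      also have "\<dots> = f z - c * z ^ Suc k"
        unfolding A(2)[OF z] q(2)[OF z] by (simp add: algebra_simps)
      finally show ?thesis .
    qed
    ultimately show ?case by blast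
  qed
  then show thesis using that by blast
qed

text \<open>
  Dividing the equation by \<open>z^k\<close> gives \<open>f = c + z (A/z^k)'\<close>, and a derivative has no term of degree \<open>-1\<close>.
\<close>

lemma laurent_constant_term:
  assumes \<rho>: "\<rho> > 0" and A: "A holomorphic_on ball 0 \<rho>"
    and eq: "\<And>z. z \<in> ball 0 \<rho> \<Longrightarrow> z * deriv A z - of_nat k * A z = h z - c * z ^ k"
    and f: "\<And>z. z \<in> ball 0 \<rho> - {0} \<Longrightarrow> f z = h z / z ^ k"
  shows "fls_nth (laurent_expansion f 0) 0 = c"
proof -
  define a where "a z = A z / z ^ k" for z
  have "A analytic_on {0}" using A \<rho> by (metis analytic_on_open analytic_on_subset centre_in_ball empty_subsetI insert_subset open_ball)
  then have "A has_laurent_expansion fps_to_fls (fps_expansion A 0)"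
    by (intro has_laurent_expansion_fps analytic_at_imp_has_fps_expansion_0)
  then have "a has_laurent_expansion (fps_to_fls (fps_expansion A 0) / fls_X_intpow (int k))"
    unfolding a_def by (intro laurent_expansion_intros)
  then obtain L where L: "a has_laurent_expansion L" by blast
  have "(\<lambda>z. c + z * deriv a z) has_laurent_expansion (fls_const c + fls_X * fls_deriv L)"
    by (intro laurent_expansion_intros L)
  moreover have "\<forall>\<^sub>F z in at 0. c + z * deriv a z = f z"
  proof -
    have "\<forall>\<^sub>F z in at 0. z \<in> ball 0 \<rho> - {0}"
      using \<rho> by (intro eventually_at_in_open) auto
    then show ?thesis
    proof eventually_elim
      case (elim z)
      then have z: "z \<in> ball 0 \<rho>" "z \<noteq> 0" by auto
      have "(a has_field_derivative (deriv A z * z ^ k - A z * (of_nat k * (1 * z ^ (k - Suc 0)))) / (z ^ k * z ^ k)) (at z)"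
        unfolding a_def
        by (intro DERIV_divide DERIV_power DERIV_ident holomorphic_derivI[OF A open_ball z(1)]) (use z in simp)
      then have "z * deriv a z = z * ((deriv A z * z ^ k - A z * (of_nat k * z ^ (k - 1))) / (z ^ k * z ^ k))"
        using DERIV_imp_deriv by fastforce
      also have "\<dots> = (z * deriv A z - of_nat k * A z) / z ^ k"
        using z(2) by (cases k) (auto simp: field_simps)
      also have "\<dots> = f z - c" unfolding eq[OF z(1)] f[OF elim] using z(2) by (simp add: field_simps)
      finally show ?case by simp
    qed
  qed
  ultimately have "f has_laurent_expansion (fls_const c + fls_X * fls_deriv L)"
    using has_laurent_expansion_cong by fast
  then show ?thesis by (simp add: laurent_expansion_0_eqI fls_X_times_conv_shift)
qed

section \<open>Normal form of the coefficient\<close>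

lemma meromorphic_normal_form:
  assumes "f meromorphic_on {0}"
  obtains k h \<rho> where "\<rho> > 0" "h holomorphic_on ball 0 \<rho>" "k = 0 \<or> h 0 \<noteq> 0"
    "\<And>z. z \<in> ball 0 \<rho> - {0} \<Longrightarrow> f z = h z / z ^ k"
proof (cases "\<exists>\<^sub>F z in at 0. f z \<noteq> 0")
  case False
  then have "\<forall>\<^sub>F z in at 0. f z = 0" by (simp add: frequently_def)
  then obtain \<rho> where "\<rho> > 0" "\<And>z. z \<in> ball 0 \<rho> - {0} \<Longrightarrow> f z = 0"
    unfolding eventually_at by (auto simp: dist_commute)
  then show thesis using that[of \<rho> "\<lambda>_. 0" 0] by simp
next
  case True
  have "(\<lambda>w. f (0 + w)) has_laurent_expansion laurent_expansion f 0"
    using assms meromorphic_on_imp_has_laurent_expansion by blast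
  then have "isolated_singularity_at f 0" "not_essential f 0"
    using has_laurent_expansion_isolated has_laurent_expansion_not_essential by auto
  from zorder_exist[OF this True] obtain r where r: "zor_poly f 0 0 \<noteq> 0" "r > 0"
    "zor_poly f 0 holomorphic_on cball 0 r"
    "\<And>w. w \<in> cball 0 r - {0} \<Longrightarrow> f w = zor_poly f 0 w * w powi zorder f 0"
    by auto
  have holo: "zor_poly f 0 holomorphic_on ball 0 r" using r(3) by (rule holomorphic_on_subset) auto
  show thesis
  proof (cases "zorder f 0 \<ge> 0")
    case True
    show thesis
      by (rule that[of r "\<lambda>w. zor_poly f 0 w * w ^ nat (zorder f 0)" 0])
        (use r True in \<open>auto intro!: holomorphic_intros holo simp: power_int_def\<close>)
  next
    case False
    show thesis
      by (rule that[of r "zor_poly f 0" "nat (- zorder f 0)"])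
        (use r False in \<open>auto intro!: holo simp: power_int_def divide_inverse power_inverse\<close>)
  qed
qed

text \<open>
  Along a line on which the second coordinate is fixed, a pole of order \<open>k\<close> in \<open>z = D x^n\<close> is
  compensated by \<open>x^a\<close>.  If \<open>a < kn\<close>, multiplying by the missing power of \<open>x\<close> sends the left-hand side to \<open>0\<close>
  while the right-hand side tends to \<open>C h(0) \<noteq> 0\<close>.
\<close>

lemma pole_order_bound:
  fixes \<phi> f h :: "complex \<Rightarrow> complex"
  assumes \<rho>: "\<rho> > 0" and h: "h holomorphic_on ball 0 \<rho>" "k = 0 \<or> h 0 \<noteq> 0"
    and f: "\<And>z. z \<in> ball 0 \<rho> - {0} \<Longrightarrow> f z = h z / z ^ k"
    and \<phi>: "isCont \<phi> 0" "\<forall>\<^sub>F x in at 0. \<phi> x = x ^ a * C * f (x ^ n * D)"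
    and n: "n > 0" and CD: "C \<noteq> 0" "D \<noteq> 0"
  shows "k * n \<le> a"
proof (rule ccontr)
  assume "\<not> k * n \<le> a"
  then have less: "a < k * n" and h0: "h 0 \<noteq> 0" using h(2) by auto
  have mono: "((\<lambda>x::complex. x ^ n * D) \<longlongrightarrow> 0) (at 0)"
    using n by (auto intro!: tendsto_eq_intros simp: zero_power)
  have "\<forall>\<^sub>F x in at 0. x ^ n * D \<in> ball 0 \<rho>"
    using tendstoD[OF mono \<rho>] by simp
  moreover have "\<forall>\<^sub>F x in at (0::complex). x \<noteq> 0" by (simp add: eventually_at_filter)
  ultimately have ev: "\<forall>\<^sub>F x in at 0. \<phi> x * x ^ (k * n - a) * D ^ k = C * h (x ^ n * D)"
    using \<phi>(2)
  proof eventually_elim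
    case (elim x)
    then have "f (x ^ n * D) = h (x ^ n * D) / (x ^ n * D) ^ k" using CD by (intro f) auto
    moreover have "(x ^ n * D) ^ k = x ^ a * x ^ (k * n - a) * D ^ k"
      using less by (simp add: power_mult_distrib power_mult[symmetric] power_add[symmetric] mult.commute)
    ultimately show ?case using elim CD by simp
  qed
  have "(\<phi> \<longlongrightarrow> \<phi> 0) (at 0)" using \<phi>(1) by (simp add: isCont_def)
  then have "((\<lambda>x. \<phi> x * x ^ (k * n - a) * D ^ k) \<longlongrightarrow> \<phi> 0 * 0 ^ (k * n - a) * D ^ k) (at 0)"
    by (intro tendsto_intros)
  then have "((\<lambda>x. \<phi> x * x ^ (k * n - a) * D ^ k) \<longlongrightarrow> 0) (at 0)"
    using less by (simp add: zero_power)
  then have "((\<lambda>x. C * h (x ^ n * D)) \<longlongrightarrow> 0) (at 0)"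
    using ev by (simp add: filterlim_cong)
  moreover have "isCont h 0" using h(1) \<rho> holomorphic_on_imp_continuous_on continuous_on_interior
    by (metis centre_in_ball interior_open open_ball)
  then have "((\<lambda>x. C * h (x ^ n * D)) \<longlongrightarrow> C * h 0) (at 0)"
    by (intro tendsto_intros isCont_tendsto_compose[OF _ mono])
  ultimately have "C * h 0 = 0" using tendsto_unique trivial_limit_at by blast
  then show False using CD h0 by simp
qed

text \<open>
  The pole bound is applied on the two lines through \<open>(0, y0)\<close> and \<open>(x0, 0)\<close> parallel to the axes.
  Off the axes the formula is then arithmetic with exponents, and it extends to the axes by
  continuity.
\<close>

lemma extension_formula:
  fixes F :: "complex \<times> complex \<Rightarrow> complex"
  assumes pos: "n > 0" "m > 0" and W: "open W" "(0, 0) \<in> W"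
    and F_cont: "\<And>p. p \<in> W \<Longrightarrow> isCont F p"
    and F_eq: "\<And>x y. (x, y) \<in> W \<Longrightarrow> x \<noteq> 0 \<Longrightarrow> y \<noteq> 0 \<Longrightarrow> F (x, y) = x ^ a * y ^ b * f (x ^ n * y ^ m)"
    and \<rho>: "\<rho> > 0" and h: "h holomorphic_on ball 0 \<rho>" "k = 0 \<or> h 0 \<noteq> 0"
    and f: "\<And>z. z \<in> ball 0 \<rho> - {0} \<Longrightarrow> f z = h z / z ^ k"
  obtains \<alpha> \<beta> where "a = \<alpha> + k * n" "b = \<beta> + k * m"
    "\<And>x y. (x, y) \<in> W \<Longrightarrow> x ^ n * y ^ m \<in> ball 0 \<rho> \<Longrightarrow> F (x, y) = x ^ \<alpha> * y ^ \<beta> * h (x ^ n * y ^ m)"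
proof -
  obtain V V' where V: "open V" "open V'" "0 \<in> V" "0 \<in> V'" "V \<times> V' \<subseteq> W"
    using W by (auto elim!: open_prod_elim)
  have ne: "\<exists>x\<in>S. x \<noteq> 0" if "open S" "0 \<in> S" for S :: "complex set"
    using that by (metis not_open_singleton singleton_iff subsetI subset_antisym empty_subsetI insert_subset)
  obtain x0 y0 where xy0: "x0 \<in> V" "x0 \<noteq> 0" "y0 \<in> V'" "y0 \<noteq> 0"
    using ne V by metis
  have "k * n \<le> a"
  proof (rule pole_order_bound[OF \<rho> h f])
    have "isCont F (0, y0)" using V xy0 F_cont by auto
    then show "isCont (\<lambda>x. F (x, y0)) 0"
      by (intro isCont_o2[where g = F and f = "\<lambda>x. (x, y0)"] continuous_intros)
    have "\<forall>\<^sub>F x in at 0. x \<in> V - {0}" using V by (intro eventually_at_in_open) auto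
    then show "\<forall>\<^sub>F x in at 0. F (x, y0) = x ^ a * y0 ^ b * f (x ^ n * y0 ^ m)"
      by eventually_elim (use V xy0 F_eq in auto)
  qed (use pos xy0 in auto)
  moreover have "k * m \<le> b"
  proof (rule pole_order_bound[OF \<rho> h f])
    have "isCont F (x0, 0)" using V xy0 F_cont by auto
    then show "isCont (\<lambda>y. F (x0, y)) 0"
      by (intro isCont_o2[where g = F and f = "\<lambda>y. (x0, y)"] continuous_intros)
    have "\<forall>\<^sub>F y in at 0. y \<in> V' - {0}" using V by (intro eventually_at_in_open) auto
    then show "\<forall>\<^sub>F y in at 0. F (x0, y) = y ^ b * x0 ^ a * f (y ^ m * x0 ^ n)"
      by eventually_elim (use V xy0 F_eq in \<open>auto simp: mult_ac\<close>)
  qed (use pos xy0 in auto)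
  ultimately obtain \<alpha> \<beta> where ab: "a = \<alpha> + k * n" "b = \<beta> + k * m"
    by (metis le_add_diff_inverse2)
  have off_axes: "F (x, y) = x ^ \<alpha> * y ^ \<beta> * h (x ^ n * y ^ m)"
    if "(x, y) \<in> W" "x ^ n * y ^ m \<in> ball 0 \<rho>" "x \<noteq> 0" "y \<noteq> 0" for x y
  proof -
    have "f (x ^ n * y ^ m) = h (x ^ n * y ^ m) / (x ^ n * y ^ m) ^ k" using that by (intro f) auto
    moreover have "(x ^ n * y ^ m) ^ k = x ^ (k * n) * y ^ (k * m)"
      by (simp add: power_mult_distrib power_mult[symmetric] mult.commute)
    ultimately show ?thesis using F_eq[OF that(1,3,4)] that(3,4) by (simp add: ab power_add)
  qed
  have "F (x, y) = x ^ \<alpha> * y ^ \<beta> * h (x ^ n * y ^ m)"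
    if xy: "(x, y) \<in> W" "x ^ n * y ^ m \<in> ball 0 \<rho>" for x y
  proof -
    \<comment> \<open>For small \<open>t \<noteq> 0\<close> the diagonally displaced point lies off both axes.\<close>
    have lim: "((\<lambda>t. (x + t, y + t)) \<longlongrightarrow> (x, y)) (at 0)"
      by (auto intro!: tendsto_eq_intros)
    have limz: "((\<lambda>t. (x + t) ^ n * (y + t) ^ m) \<longlongrightarrow> x ^ n * y ^ m) (at 0)"
      by (auto intro!: tendsto_eq_intros)
    have lim1: "((\<lambda>t. F (x + t, y + t)) \<longlongrightarrow> F (x, y)) (at 0)"
      by (rule isCont_tendsto_compose[OF F_cont[OF xy(1)] lim])
    have "isCont h (x ^ n * y ^ m)"
      using h(1) xy(2) holomorphic_on_imp_continuous_on continuous_on_interior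
      by (metis interior_open open_ball)
    then have lim2: "((\<lambda>t. (x + t) ^ \<alpha> * (y + t) ^ \<beta> * h ((x + t) ^ n * (y + t) ^ m)) \<longlongrightarrow>
        (x + 0) ^ \<alpha> * (y + 0) ^ \<beta> * h (x ^ n * y ^ m)) (at 0)"
      by (intro tendsto_intros isCont_tendsto_compose[OF _ limz])
    have ev: "\<forall>\<^sub>F t in at 0. F (x + t, y + t) = (x + t) ^ \<alpha> * (y + t) ^ \<beta> * h ((x + t) ^ n * (y + t) ^ m)"
    proof -
      have "\<forall>\<^sub>F t in at 0. (x + t, y + t) \<in> W"
        by (rule topological_tendstoD[OF lim W(1) xy(1)])
      moreover have "\<forall>\<^sub>F t in at 0. (x + t) ^ n * (y + t) ^ m \<in> ball 0 \<rho>"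
        by (rule topological_tendstoD[OF limz open_ball xy(2)])
      moreover have "\<forall>\<^sub>F t in at 0. x + t \<noteq> 0" "\<forall>\<^sub>F t in at 0. y + t \<noteq> 0"
        using eventually_neq_at_within[of "- x" 0] eventually_neq_at_within[of "- y" 0]
        by (auto elim!: eventually_mono simp: add_eq_0_iff)
      ultimately show ?thesis by eventually_elim (rule off_axes)
    qed
    show ?thesis
      using tendsto_unique[OF trivial_limit_at lim1 iffD2[OF tendsto_cong[OF ev] lim2]] by simp
  qed
  then show thesis using that ab by blast
qed

section \<open>Flows of the two kinds of generator\<close>

text \<open>
  Let \<open>z L'(z) = 1/g(z) - 1/g(0)\<close>.  Then \<open>\<zeta> = z exp(g(0) L(z))\<close> linearizes the flow, so that
  \<open>log \<zeta>\<close> grows at the constant rate \<open>l g(0)\<close>.  A term of degree \<open>k\<close> in \<open>h\<close> asks for a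
  logarithm of \<open>z\<close>, and \<open>log z = log \<zeta> - g(0) L(z)\<close> splits it into a multiple of the time, which becomes the
  constant \<open>c\<close>, and the single-valued correction that enters \<open>A\<close>.
\<close>

lemma scaling_flow_nonvanishing_generator:
  fixes g h :: "complex \<Rightarrow> complex" and l q :: complex
  assumes \<rho>: "\<rho> > 0" and g: "g holomorphic_on ball 0 \<rho>" "g 0 \<noteq> 0"
    and h: "h holomorphic_on ball 0 \<rho>" and l: "l \<noteq> 0"
  obtains B Q E c A where "B \<subseteq> ball 0 \<rho>" "scaling_flow B Q E (\<lambda>z. l * g z)" "A holomorphic_on B"
    "\<And>z. z \<in> B \<Longrightarrow> c * z ^ k + l * g z * (z * deriv A z - of_nat k * A z) = q * g z * h z"
    "\<And>z. z \<in> B \<Longrightarrow> z \<noteq> 0 \<Longrightarrow> g z \<noteq> 0"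
proof -
  have "isCont g 0"
    using g(1) \<rho> holomorphic_on_imp_continuous_on continuous_on_interior
    by (metis centre_in_ball interior_open open_ball)
  then obtain \<sigma>' where \<sigma>': "\<sigma>' > 0" "\<And>z. z \<in> ball 0 \<sigma>' \<Longrightarrow> g z \<noteq> 0"
    using continuous_at_avoid[of 0 g 0] g(2) by (auto simp: dist_commute)
  define \<sigma> where "\<sigma> = min \<rho> \<sigma>'"
  have \<sigma>: "\<sigma> > 0" "ball (0::complex) \<sigma> \<subseteq> ball 0 \<rho>" "\<And>z. z \<in> ball 0 \<sigma> \<Longrightarrow> g z \<noteq> 0"
    using \<rho> \<sigma>' by (auto simp: \<sigma>_def)
  have g': "g holomorphic_on ball 0 \<sigma>" and h': "h holomorphic_on ball 0 \<sigma>"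
    using g(1) h \<sigma>(2) holomorphic_on_subset by blast+
  have "(\<lambda>z. 1 / g z) holomorphic_on ball 0 \<sigma>" by (intro holomorphic_intros g' \<sigma>(3))
  then obtain L c where L: "L holomorphic_on ball 0 \<sigma>"
    "\<And>z. z \<in> ball 0 \<sigma> \<Longrightarrow> z * deriv L z - of_nat 0 * L z = 1 / g z - c * z ^ 0"
    using euler_primitive[OF _ \<sigma>(1), of _ 0] by blast
  have "c = 1 / g 0" using L(2)[of 0] \<sigma>(1) by simp
  then have L': "z * deriv L z = 1 / g z - 1 / g 0" if "z \<in> ball 0 \<sigma>" for z
    using L(2)[OF that] by simp
  obtain A0 c0 where A0: "A0 holomorphic_on ball 0 \<sigma>"
    "\<And>z. z \<in> ball 0 \<sigma> \<Longrightarrow> z * deriv A0 z - of_nat k * A0 z = h z - c0 * z ^ k"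
    using euler_primitive[OF h' \<sigma>(1)] by blast
  define P where "P z = exp (g 0 * L z)" for z
  have dP: "(P has_field_derivative P z * (g 0 * deriv L z)) (at z)" if "z \<in> ball 0 \<sigma>" for z
    unfolding P_def
    by (rule derivative_eq_intros holomorphic_derivI[OF L(1) open_ball that] refl | simp)+
  have Pholo: "P holomorphic_on ball 0 \<sigma>" unfolding P_def by (intro holomorphic_intros L(1))
  have P0: "P z \<noteq> 0" if "z \<in> ball 0 \<sigma>" for z using \<sigma>(3)[OF that] by (simp add: P_def)
  have conj: "(P z + z * deriv P z) * (l * g z) = P z * (l * g 0)" if z: "z \<in> ball 0 \<sigma>" for z
  proof -
    have "P z + z * deriv P z = P z * (1 + g 0 * (z * deriv L z))"
      using DERIV_imp_deriv[OF dP[OF z]] by (simp add: algebra_simps)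
    also have "\<dots> = P z * (g 0 / g z)" unfolding L'[OF z] using g(2) by (simp add: algebra_simps)
    finally show ?thesis using \<sigma>(3)[OF z] by (simp add: field_simps)
  qed
  obtain B Q E where B: "B \<subseteq> ball 0 \<sigma>" "scaling_flow B Q E (\<lambda>z. l * g z)"
    by (rule scaling_flow_conjugate[OF \<sigma>(1) Pholo P0 scaling_flow_exp conj]) (assumption | rule that)+
  define A where "A z = q / l * (A0 z - c0 * g 0 * (z ^ k * L z))" for z
  have "A holomorphic_on ball 0 \<sigma>" unfolding A_def by (intro holomorphic_intros A0(1) L(1))
  then have "A holomorphic_on B" using B(1) holomorphic_on_subset by blast
  moreover have "q * c0 * g 0 * z ^ k + l * g z * (z * deriv A z - of_nat k * A z) = q * g z * h z"
    if "z \<in> B" for z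
  proof -
    have z: "z \<in> ball 0 \<sigma>" using that B(1) by blast
    have dA: "(A has_field_derivative q / l * (deriv A0 z - c0 * g 0 *
        (of_nat k * (1 * z ^ (k - Suc 0)) * L z + deriv L z * z ^ k))) (at z)"
      unfolding A_def
      by (intro DERIV_cmult DERIV_diff DERIV_mult DERIV_power DERIV_ident
          holomorphic_derivI[OF A0(1) open_ball z] holomorphic_derivI[OF L(1) open_ball z])
    have "z * deriv A z = q / l * (z * deriv A0 z - c0 * g 0 *
        (of_nat k * (z * z ^ (k - 1)) * L z + z * deriv L z * z ^ k))"
      unfolding DERIV_imp_deriv[OF dA] by (simp add: algebra_simps)
    also have "of_nat k * (z * z ^ (k - 1)) = of_nat k * z ^ k" by (cases k) auto
    finally have zA: "z * deriv A z = q / l * (z * deriv A0 z - c0 * g 0 *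
        (of_nat k * z ^ k * L z + z * deriv L z * z ^ k))" .
    have "l * g z * (z * deriv A z - of_nat k * A z) = q * g z * ((z * deriv A0 z - of_nat k * A0 z) -
        c0 * g 0 * z ^ k * (z * deriv L z))"
      unfolding zA using l by (simp add: A_def field_simps)
    also have "\<dots> = q * g z * h z - q * c0 * g 0 * z ^ k"
      unfolding L'[OF z] A0(2)[OF z] using \<sigma>(3)[OF z] g(2) by (simp add: field_simps)
    finally show ?thesis by simp
  qed
  ultimately show thesis
    using that[of B Q E A "q * c0 * g 0"] B \<sigma>(2,3) by blast
qed

text \<open>
  Write \<open>g = z G\<close>.  The time form \<open>dz/(l z^2 G(z))\<close> has the primitive \<open>T(z)/z\<close> with \<open>T\<close> holomorphic
  and \<open>T(0) \<noteq> 0\<close>, because its residue is a multiple of \<open>G'(0) = g''(0)/2 = 0\<close>.  Since time passes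
  uniformly in \<open>T(z)/z\<close>, the coordinate \<open>\<zeta> = -z/T(z)\<close> conjugates the flow to \<open>\<zeta>/(1 - t\<zeta>)\<close>.  The
  constant Laurent coefficient of \<open>f\<close> is the obstruction to integrating \<open>f(z) dz/z\<close>, so no term linear in the time
  arises and \<open>c = 0\<close>.
\<close>

lemma scaling_flow_double_zero_generator:
  fixes f g h :: "complex \<Rightarrow> complex" and l q :: complex
  assumes \<rho>: "\<rho> > 0" and g: "g holomorphic_on ball 0 \<rho>" "g 0 = 0" "deriv g 0 \<noteq> 0" "(deriv ^^ 2) g 0 = 0"
    and h: "h holomorphic_on ball 0 \<rho>" and l: "l \<noteq> 0"
    and f: "\<And>z. z \<in> ball 0 \<rho> - {0} \<Longrightarrow> f z = h z / z ^ k" "fls_nth (laurent_expansion f 0) 0 = 0"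
  obtains B Q E c A where "B \<subseteq> ball 0 \<rho>" "scaling_flow B Q E (\<lambda>z. l * g z)" "A holomorphic_on B"
    "\<And>z. z \<in> B \<Longrightarrow> c * z ^ k + l * g z * (z * deriv A z - of_nat k * A z) = q * g z * h z"
    "\<And>z. z \<in> B \<Longrightarrow> z \<noteq> 0 \<Longrightarrow> g z \<noteq> 0"
proof -
  obtain G where G: "G holomorphic_on ball 0 \<rho>" "\<And>z. z \<in> ball 0 \<rho> \<Longrightarrow> g z = z * G z"
    using holomorphic_split_value[OF g(1) \<rho>] g(2) by auto
  have z\<rho>: "(0 :: complex) \<in> ball 0 \<rho>" using \<rho> by simp
  have dg: "deriv g z = G z + z * deriv G z" if z: "z \<in> ball 0 \<rho>" for z
  proof -
    have "((\<lambda>z. z * G z) has_field_derivative 1 * G z + deriv G z * z) (at z)"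
      by (intro DERIV_mult DERIV_ident holomorphic_derivI[OF G(1) open_ball z])
    then have "(g has_field_derivative 1 * G z + deriv G z * z) (at z)"
      by (rule has_field_derivative_transform_within_open[OF _ open_ball z]) (simp add: G(2))
    then show ?thesis using DERIV_imp_deriv by fastforce
  qed
  have G0: "G 0 \<noteq> 0" using dg[OF z\<rho>] g(3) by simp
  have dG0: "deriv G 0 = 0"
  proof -
    have G': "deriv G holomorphic_on ball 0 \<rho>" by (intro holomorphic_deriv G(1) open_ball)
    have "((\<lambda>z. G z + z * deriv G z) has_field_derivative
        deriv G 0 + (1 * deriv G 0 + deriv (deriv G) 0 * 0)) (at 0)"
      by (intro DERIV_add DERIV_mult DERIV_ident holomorphic_derivI[OF G(1) open_ball z\<rho>]
          holomorphic_derivI[OF G' open_ball z\<rho>])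
    then have "(deriv g has_field_derivative deriv G 0 + (1 * deriv G 0 + deriv (deriv G) 0 * 0)) (at 0)"
      by (rule has_field_derivative_transform_within_open[OF _ open_ball z\<rho>]) (simp add: dg)
    then have "deriv (deriv g) 0 = 2 * deriv G 0" using DERIV_imp_deriv by fastforce
    then show ?thesis using g(4) by (simp add: numeral_2_eq_2)
  qed
  have "isCont G 0"
    using G(1) \<rho> holomorphic_on_imp_continuous_on continuous_on_interior
    by (metis centre_in_ball interior_open open_ball)
  then obtain \<tau>' where \<tau>': "\<tau>' > 0" "\<And>z. z \<in> ball 0 \<tau>' \<Longrightarrow> G z \<noteq> 0"
    using continuous_at_avoid[of 0 G 0] G0 by (auto simp: dist_commute)
  define \<tau> where "\<tau> = min \<rho> \<tau>'"
  have \<tau>: "\<tau> > 0" "ball (0::complex) \<tau> \<subseteq> ball 0 \<rho>" "\<And>z. z \<in> ball 0 \<tau> \<Longrightarrow> G z \<noteq> 0"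
    using \<rho> \<tau>' by (auto simp: \<tau>_def)
  have z\<tau>: "(0 :: complex) \<in> ball 0 \<tau>" using \<tau>(1) by simp
  have G\<tau>: "G holomorphic_on ball 0 \<tau>" using G(1) \<tau>(2) holomorphic_on_subset by blast
  have "(\<lambda>z. 1 / (l * G z)) holomorphic_on ball 0 \<tau>"
    using l \<tau>(3) by (intro holomorphic_intros G\<tau>) auto
  then obtain T c where T: "T holomorphic_on ball 0 \<tau>"
    "\<And>z. z \<in> ball 0 \<tau> \<Longrightarrow> z * deriv T z - of_nat 1 * T z = 1 / (l * G z) - c * z ^ 1"
    using euler_primitive[OF _ \<tau>(1), of _ 1] by blast
  \<comment> \<open>The derivative of \<open>z T' - T\<close> at \<open>0\<close> vanishes, and so does that of \<open>1/(l G)\<close>.\<close>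
  have "c = 0"
  proof -
    have T': "deriv T holomorphic_on ball 0 \<tau>" by (intro holomorphic_deriv T(1) open_ball)
    have "((\<lambda>z. z * deriv T z - T z) has_field_derivative
        (1 * deriv T 0 + deriv (deriv T) 0 * 0) - deriv T 0) (at 0)"
      by (intro DERIV_diff DERIV_mult DERIV_ident holomorphic_derivI[OF T(1) open_ball z\<tau>]
          holomorphic_derivI[OF T' open_ball z\<tau>])
    then have "((\<lambda>z. 1 / (l * G z) - c * z) has_field_derivative
        (1 * deriv T 0 + deriv (deriv T) 0 * 0) - deriv T 0) (at 0)"
      by (rule has_field_derivative_transform_within_open[OF _ open_ball z\<tau>]) (use T(2) in simp)
    moreover have "((\<lambda>z. 1 / (l * G z) - c * z) has_field_derivative
        (0 * (l * G 0) - 1 * (l * deriv G 0)) / (l * G 0 * (l * G 0)) - c * 1) (at 0)"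
      using l G0 by (intro DERIV_diff DERIV_divide DERIV_cmult DERIV_const DERIV_ident
          holomorphic_derivI[OF G\<tau> open_ball z\<tau>]) simp
    ultimately show "c = 0" using DERIV_unique dG0 by fastforce
  qed
  then have T': "z * deriv T z - T z = 1 / (l * G z)" if "z \<in> ball 0 \<tau>" for z
    using T(2)[OF that] by simp
  have "T 0 \<noteq> 0" using T'[OF z\<tau>] l G0 by (metis diff_0 divide_eq_0_iff mult_eq_0_iff mult_zero_left neg_equal_0_iff_equal one_neq_zero)
  moreover have "isCont T 0"
    using T(1) \<tau>(1) holomorphic_on_imp_continuous_on continuous_on_interior
    by (metis centre_in_ball interior_open open_ball)
  ultimately obtain \<sigma>' where \<sigma>': "\<sigma>' > 0" "\<And>z. z \<in> ball 0 \<sigma>' \<Longrightarrow> T z \<noteq> 0"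
    using continuous_at_avoid[of 0 T 0] by (auto simp: dist_commute)
  define \<sigma> where "\<sigma> = min \<tau> \<sigma>'"
  have \<sigma>: "\<sigma> > 0" "ball (0::complex) \<sigma> \<subseteq> ball 0 \<tau>" "\<And>z. z \<in> ball 0 \<sigma> \<Longrightarrow> T z \<noteq> 0"
    using \<tau>(1) \<sigma>' by (auto simp: \<sigma>_def)
  define P where "P z = - 1 / T z" for z
  have T\<sigma>: "T holomorphic_on ball 0 \<sigma>" using T(1) \<sigma>(2) holomorphic_on_subset by blast
  have Pholo: "P holomorphic_on ball 0 \<sigma>" unfolding P_def using \<sigma>(3) by (intro holomorphic_intros T\<sigma>)
  have P0: "P z \<noteq> 0" if "z \<in> ball 0 \<sigma>" for z using \<sigma>(3)[OF that] by (simp add: P_def)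
  have conj: "(P z + z * deriv P z) * (l * g z) = P z * (z * P z)" if z: "z \<in> ball 0 \<sigma>" for z
  proof -
    have z': "z \<in> ball 0 \<tau>" using z \<sigma>(2) by blast
    have dP: "(P has_field_derivative (0 * T z - (- 1) * deriv T z) / (T z * T z)) (at z)"
      unfolding P_def
      by (intro DERIV_divide DERIV_const holomorphic_derivI[OF T\<sigma> open_ball z] \<sigma>(3) z)
    have "P z + z * deriv P z = (z * deriv T z - T z) / (T z * T z)"
      unfolding DERIV_imp_deriv[OF dP] using \<sigma>(3)[OF z] by (simp add: P_def field_simps)
    also have "\<dots> = 1 / (l * G z) / (T z * T z)" unfolding T'[OF z'] ..
    finally have PP: "P z + z * deriv P z = 1 / (l * G z) / (T z * T z)" .
    have "z \<in> ball 0 \<rho>" using z' \<tau>(2) by blast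
    then show ?thesis
      unfolding PP using \<sigma>(3)[OF z] \<tau>(3)[OF z'] l by (simp add: G(2) P_def field_simps)
  qed
  obtain B Q E where B: "B \<subseteq> ball 0 \<sigma>" "scaling_flow B Q E (\<lambda>z. l * g z)"
    by (rule scaling_flow_conjugate[OF \<sigma>(1) Pholo P0 scaling_flow_quadratic conj]) (assumption | rule that)+
  obtain A0 c0 where A0: "A0 holomorphic_on ball 0 \<rho>"
    "\<And>z. z \<in> ball 0 \<rho> \<Longrightarrow> z * deriv A0 z - of_nat k * A0 z = h z - c0 * z ^ k"
    using euler_primitive[OF h \<rho>] by blast
  have c0: "c0 = 0" using laurent_constant_term[OF \<rho> A0 f(1)] f(2) by simp
  define A where "A z = q / l * A0 z" for z
  have B\<rho>: "B \<subseteq> ball 0 \<rho>" using B(1) \<sigma>(2) \<tau>(2) by blast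
  have "A holomorphic_on ball 0 \<rho>" unfolding A_def by (intro holomorphic_intros A0(1))
  then have "A holomorphic_on B" using B\<rho> holomorphic_on_subset by blast
  moreover have "0 * z ^ k + l * g z * (z * deriv A z - of_nat k * A z) = q * g z * h z"
    if "z \<in> B" for z
  proof -
    have z: "z \<in> ball 0 \<rho>" using that B\<rho> by blast
    have "(A has_field_derivative q / l * deriv A0 z) (at z)"
      unfolding A_def by (intro DERIV_cmult holomorphic_derivI[OF A0(1) open_ball z])
    then have dA: "deriv A z = q / l * deriv A0 z" by (rule DERIV_imp_deriv)
    have "l * g z * (z * deriv A z - of_nat k * A z) = q * g z * (z * deriv A0 z - of_nat k * A0 z)"
      unfolding dA using l by (simp add: A_def field_simps)
    then show ?thesis using A0(2)[OF z] c0 by simp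
  qed
  moreover have "g z \<noteq> 0" if "z \<in> B" "z \<noteq> 0" for z
  proof -
    have "z \<in> ball 0 \<tau>" "z \<in> ball 0 \<rho>" using that B(1) \<sigma>(2) B\<rho> by blast+
    then show ?thesis using \<tau>(3) G(2) that(2) by simp
  qed
  ultimately show thesis
    using that[of B Q E A 0] B(2) B\<rho> by blast
qed

section \<open>Univalence near the origin\<close>

theorem proposition3p1:
  fixes a b m n :: nat
    and f g :: "complex \<Rightarrow> complex"
    and F :: "complex \<times> complex \<Rightarrow> complex"
    and W :: "(complex \<times> complex) set"
  assumes pos: "a > 0" "b > 0" "m > 0" "n > 0"
    and unimodular: "int a * int m - int b * int n \<in> {-1, 1}"
    and g_holo: "g analytic_on {0}"
    and f_mero: "f meromorphic_on {0}"
    and W: "open W" "(0, 0) \<in> W"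
    and F_holo: "F multi_holomorphic_on W"
    and F_eq: "\<And>x y. (x, y) \<in> W \<Longrightarrow> x \<noteq> 0 \<Longrightarrow> y \<noteq> 0 \<Longrightarrow>
                 F (x, y) = x ^ a * y ^ b * f (x ^ n * y ^ m)"
    and F_order: "F (0, 0) = 0"
    and cases: "g 0 \<noteq> 0 \<or>
      (g 0 = 0 \<and> (deriv ^^ 2) g 0 = 0 \<and> fls_nth (laurent_expansion f 0) 0 = 0 \<and> deriv g 0 \<noteq> 0)"
  shows "\<exists>U0. open U0 \<and> (0, 0) \<in> U0 \<and>
    (\<forall>U. open U \<longrightarrow> connected U \<longrightarrow> (0, 0) \<in> U \<longrightarrow> U \<subseteq> U0 \<longrightarrow>
      univalent_C2_on (generated_lie_algebra U {field_X a b m n, field_Y a b m n g F}) U)"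
proof -
  define \<epsilon> where "\<epsilon> = int a * int m - int b * int n"
  obtain k h \<rho>1 where h1: "\<rho>1 > 0" "h holomorphic_on ball 0 \<rho>1" "k = 0 \<or> h 0 \<noteq> 0"
    "\<And>z. z \<in> ball 0 \<rho>1 - {0} \<Longrightarrow> f z = h z / z ^ k"
    by (rule meromorphic_normal_form[OF f_mero]) (rule that)
  obtain \<rho>2 where \<rho>2: "\<rho>2 > 0" "g holomorphic_on ball 0 \<rho>2"
    using g_holo unfolding analytic_on_def by auto
  define \<rho> where "\<rho> = min \<rho>1 \<rho>2"
  have \<rho>: "\<rho> > 0" using h1 \<rho>2 by (simp add: \<rho>_def)
  have sub: "ball (0::complex) \<rho> \<subseteq> ball 0 \<rho>1" "ball (0::complex) \<rho> \<subseteq> ball 0 \<rho>2"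
    by (auto simp: \<rho>_def)
  have h: "h holomorphic_on ball 0 \<rho>" and g: "g holomorphic_on ball 0 \<rho>"
    using h1(2) \<rho>2(2) sub holomorphic_on_subset by blast+
  have f: "f z = h z / z ^ k" if "z \<in> ball 0 \<rho> - {0}" for z using that sub h1(4) by blast
  obtain \<alpha> \<beta> where \<alpha>\<beta>: "a = \<alpha> + k * n" "b = \<beta> + k * m"
    "\<And>x y. (x, y) \<in> W \<Longrightarrow> x ^ n * y ^ m \<in> ball 0 \<rho> \<Longrightarrow> F (x, y) = x ^ \<alpha> * y ^ \<beta> * h (x ^ n * y ^ m)"
  proof (rule extension_formula[OF pos(4,3) W _ F_eq \<rho> h h1(3) f])
    show "isCont F p" if "p \<in> W" for p
      using F_holo that by (auto simp: multi_holomorphic_on_iff intro: cdifferentiable_imp_isCont)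
  qed (assumption | rule that)+
  define l q :: complex where "l = of_int \<epsilon> * of_nat m" and "q = of_int \<epsilon> / of_nat m"
  have \<epsilon>: "\<epsilon> \<in> {-1, 1}" using unimodular by (simp add: \<epsilon>_def)
  then have l: "l \<noteq> 0" using pos by (auto simp: l_def)
  obtain B Q E c A where B: "B \<subseteq> ball 0 \<rho>" "scaling_flow B Q E (\<lambda>z. l * g z)" "A holomorphic_on B"
    "\<And>z. z \<in> B \<Longrightarrow> c * z ^ k + l * g z * (z * deriv A z - of_nat k * A z) = q * g z * h z"
    "\<And>z. z \<in> B \<Longrightarrow> z \<noteq> 0 \<Longrightarrow> g z \<noteq> 0"
  proof (cases "g 0 = 0")
    case False
    show thesis by (rule scaling_flow_nonvanishing_generator[OF \<rho> g False h l]) (assumption | rule that)+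
  next
    case True
    with cases have g': "deriv g 0 \<noteq> 0" "(deriv ^^ 2) g 0 = 0" "fls_nth (laurent_expansion f 0) 0 = 0" by auto
    show thesis
      by (rule scaling_flow_double_zero_generator[OF \<rho> g True g'(1,2) h l f g'(3)])
        (assumption | rule that)+
  qed
  have holo: "h holomorphic_on B" "g holomorphic_on B"
    using h g B(1) holomorphic_on_subset by blast+
  have flow: "scaling_flow B Q E (\<lambda>z. of_int \<epsilon> * of_nat m * g z)"
    using B(2) by (simp add: l_def)
  have primitive: "c * z ^ k + of_int \<epsilon> * of_nat m * g z * (z * deriv A z - of_nat k * A z) =
      of_int \<epsilon> * g z * h z / of_nat m" if "z \<in> B" for z
    using B(4)[OF that] by (simp add: l_def q_def)
  interpret monomial_flow a b m n k \<alpha> \<beta> \<epsilon> c A h g B Q E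
    by (intro monomial_flow.intro flow monomial_flow_axioms.intro pos \<epsilon> \<epsilon>_def[symmetric] \<alpha>\<beta>(1,2)
        holo B(3,5) primitive)
  define U0 where "U0 = W \<inter> (\<lambda>p. fst p ^ n * snd p ^ m) -` B"
  show ?thesis
  proof (intro exI[of _ U0] conjI allI impI)
    show "open U0" unfolding U0_def
      by (intro open_Int W open_vimage open_base continuous_intros)
    show "(0, 0) \<in> U0" using W(2) zero_in_base pos by (simp add: U0_def zero_power)
    show "univalent_C2_on (generated_lie_algebra U {field_X a b m n, field_Y a b m n g F}) U"
      if U: "open U" "connected U" "(0, 0) \<in> U" "U \<subseteq> U0" for U
    proof (rule univalent[OF U(1-3)])
      fix x y assume "(x, y) \<in> U"
      then have *: "(x, y) \<in> W" "x ^ n * y ^ m \<in> B" using U(4) by (auto simp: U0_def)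
      then show "x ^ n * y ^ m \<in> B" by simp
      show "F (x, y) = x ^ \<alpha> * y ^ \<beta> * h (x ^ n * y ^ m)" using \<alpha>\<beta>(3) * B(1) by blast
    qed
  qed
qed

end
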